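(* With high probability the algorithm greedy-forward solves the $k$-token dissemination problem in $O(nkd/b^2 + nb)$ rounds.
   Context: Dynamic network model: $n$ nodes with unique $O(\log n)$-bit identifiers, $n$ known up to factor 2; synchronous rounds; in each round $t$ an adaptive adversary (seeing all past actions but not the current round's random choices) chooses a connected undirected graph $G(t)$ on the nodes; at the start of a round each node chooses an $O(b)$-bit message ($b\ge\log n$) without knowing its neighbors, then receives the messages of all its neighbors in $G(t)$. $k$-token dissemination: $k\le n$ tokens of $d\le b$ bits are placed at nodes before round 1; all nodes must learn all tokens and terminate. Subroutine random-forward: for $O(n)$ rounds every node broadcasts $b/d$ tokens chosen uniformly at random among those it knows (and still under consideration); then a node with the maximum number of known tokens is identified by $O(n)$ rounds of flooding. Network-coded indexed broadcast: given tokens with distinct indices $1,\dots,m$, each token is viewed as a vector over $F_q$ and concatenated with the $i$-th unit vector of $F_q^m$; in each round every node broadcasts a uniformly random linear combination of all such vectors it holds or has received, and nodes decode by Gaussian elimination. Algorithm greedy-forward: while tokens remain to be broadcast, run random-forward; the identified node then broadcasts up to $b^2/d$ of its tokens (indexing them itself, grouped into blocks so that messages have size $O(b)$) using network-coded indexed broadcast for $O(n)$ rounds; all broadcast tokens are removed from consideration. "With high probability" means with probability at least $1-n^{-c}$ for a constant $c>0$. *)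

theory Defs
  imports
    "HOL-Probability.Probability"
    "HOL-Library.List_Lexorder"
    "HOL-Library.Log_Nat"
    "Jordan_Normal_Form.Gauss_Jordan_Elimination"
begin

hide_type (open) Finite_Cartesian_Product.vec
hide_const (open) Finite_Cartesian_Product.vec
no_notation Finite_Cartesian_Product.vec_nth (infixl "$" 90)

section \<open>Dynamic networks with an adaptive adversary\<close>

text \<open>Nodes are named by their unique identifiers, which are natural numbers.\<close>

type_synonym node = nat
type_synonym graph = "(node \<times> node) set"
type_synonym token = "bool list"

definition connected_graph :: "node set \<Rightarrow> graph \<Rightarrow> bool" where
  "connected_graph V E \<longleftrightarrow>
     E \<subseteq> V \<times> V \<and> sym E \<and> irrefl E \<and> (\<forall>u\<in>V. \<forall>v\<in>V. (u, v) \<in> E\<^sup>*)"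

text \<open>
  All randomness of a protocol is in the choice of the messages: the message of a node is drawn
  from a distribution that depends only on its local state, and the new local state is a function
  of the old one and of the multiset of messages received from the current neighbours.
\<close>

record ('s, 'm) protocol =
  init_state :: "node \<Rightarrow> token set \<Rightarrow> 's"
  choose_message :: "'s \<Rightarrow> 'm pmf"
  receive_messages :: "'s \<Rightarrow> 'm multiset \<Rightarrow> 's"
  terminated :: "'s \<Rightarrow> bool"
  learned :: "'s \<Rightarrow> token set"

text \<open>
  A history lists, for each past round, the messages of all nodes and the graph.  Together with the
  initial placement of the tokens it determines all past and current local states, so an adversary
  that maps histories to graphs sees everything except the random choices of the current round.
\<close>

type_synonym 'm history = "((node \<Rightarrow> 'm) \<times> graph) list"
type_synonym 'm adversary = "'m history \<Rightarrow> graph"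

definition run_round ::
  "('s, 'm) protocol \<Rightarrow> node set \<Rightarrow> 'm adversary \<Rightarrow>
   'm history \<times> (node \<Rightarrow> 's) \<Rightarrow> ('m history \<times> (node \<Rightarrow> 's)) pmf" where
  "run_round P V adv = (\<lambda>(h, \<sigma>).
     map_pmf
       (\<lambda>msg. (h @ [(msg, adv h)],
              \<lambda>v. receive_messages P (\<sigma> v) (image_mset msg (mset_set {u. (u, v) \<in> adv h}))))
       (Pi_pmf V undefined (\<lambda>v. choose_message P (\<sigma> v))))"

fun execution ::
  "('s, 'm) protocol \<Rightarrow> node set \<Rightarrow> (node \<Rightarrow> token set) \<Rightarrow> 'm adversary \<Rightarrow> nat \<Rightarrow>
   ('m history \<times> (node \<Rightarrow> 's)) pmf" where
  "execution P V I adv 0 = return_pmf ([], \<lambda>v. init_state P v (I v))"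
| "execution P V I adv (Suc t) = execution P V I adv t \<bind> run_round P V adv"

definition dissemination_done ::
  "('s, 'm) protocol \<Rightarrow> node set \<Rightarrow> token set \<Rightarrow> 'm history \<times> (node \<Rightarrow> 's) \<Rightarrow> bool" where
  "dissemination_done P V T = (\<lambda>(h, \<sigma>).
     \<forall>v\<in>V. terminated P (\<sigma> v) \<and> learned P (\<sigma> v) = T)"

section \<open>Messages and local states of greedy-forward\<close>

text \<open>The type variable \<open>'f\<close> is the finite field used for network coding.\<close>

datatype 'f message =
    Tokens "token set"
  | Candidate nat node  \<comment> \<open>number of tokens known to a node, and the identifier of that node\<close>
  | Coded "'f vec"
  | Silent

text \<open>Two bits tell the four kinds of messages apart.\<close>

fun message_bits :: "'f::finite message \<Rightarrow> nat" where
  "message_bits (Tokens S) = 2 + (\<Sum>x\<in>S. length x)"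
| "message_bits (Candidate c i) = 2 + floorlog 2 c + floorlog 2 i"
| "message_bits (Coded w) = 2 + dim_vec w * nat \<lceil>log 2 (real CARD('f))\<rceil>"
| "message_bits Silent = 2"

text \<open>
  The first argument of each of the first three stages is the number of rounds already spent in it.
  A flooding node stores the best candidate seen so far.  In the coding stage a node stores the
  number of tokens being broadcast and the set of coded vectors it holds.
\<close>

datatype 'f stage =
    Forwarding nat
  | Flooding nat "nat \<times> node"
  | Coding nat nat "'f vec set"
  | Halted

record 'f local_state =
  ident :: node
  known :: "token set"
  removed :: "token set"
  stage :: "'f stage"

definition considered :: "('f, 'z) local_state_scheme \<Rightarrow> token set" where
  "considered s = known s - removed s"

section \<open>Network-coded indexed broadcast\<close>

text \<open>
  Tokens have \<open>d\<close> bits and \<open>b div d\<close> tokens are grouped into one block, so that \<open>s\<close> tokens make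
  \<open>num_blocks b d s\<close> blocks of \<open>block_bits b d\<close> bits, the last one padded with zeros.  The blocks
  are the indexed objects that are broadcast.
\<close>

definition block_bits :: "nat \<Rightarrow> nat \<Rightarrow> nat" where
  "block_bits b d = (b div d) * d"

definition num_blocks :: "nat \<Rightarrow> nat \<Rightarrow> nat \<Rightarrow> nat" where
  "num_blocks b d s = nat \<lceil>real s / real (b div d)\<rceil>"

definition block_vec :: "nat \<Rightarrow> nat \<Rightarrow> token list \<Rightarrow> nat \<Rightarrow> 'f::field vec" where
  "block_vec b d xs i =
     vec (block_bits b d)
       (\<lambda>j. let p = i * block_bits b d + j
             in of_bool (p < length (concat xs) \<and> concat xs ! p))"

definition source_vecs :: "nat \<Rightarrow> nat \<Rightarrow> token list \<Rightarrow> 'f::field vec set" where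
  "source_vecs b d xs =
     (let m = num_blocks b d (length xs)
      in (\<lambda>i. unit_vec m i @\<^sub>v block_vec b d xs i) ` {..<m})"

definition coded_dim :: "nat \<Rightarrow> nat \<Rightarrow> nat \<Rightarrow> nat" where
  "coded_dim b d s = num_blocks b d s + block_bits b d"

definition random_combination :: "nat \<Rightarrow> 'f::{field,finite} vec set \<Rightarrow> 'f vec pmf" where
  "random_combination l W =
     map_pmf (\<lambda>c. vec l (\<lambda>j. \<Sum>w\<in>W. c w * vec_index w j))
       (Pi_pmf W 0 (\<lambda>_. pmf_of_set UNIV))"

text \<open>
  Decoding succeeds if Gaussian elimination turns the coefficient part of the matrix of held vectors
  into the identity matrix (followed by zero rows); the blocks are then read off the other columns.
\<close>

definition decode :: "nat \<Rightarrow> nat \<Rightarrow> nat \<Rightarrow> 'f::field vec set \<Rightarrow> token set" where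
  "decode b d s W =
     (let m = num_blocks b d s;
          C = gauss_jordan_single (mat_of_rows (coded_dim b d s) (SOME ws. set ws = W \<and> distinct ws));
          bits = concat (map (\<lambda>i. map (\<lambda>j. C $$ (i, m + j) = 1) [0..<block_bits b d]) [0..<m])
      in if m \<le> dim_row C \<and> (\<forall>i<m. \<forall>j<m. C $$ (i, j) = (if i = j then 1 else 0))
         then (\<lambda>p. take d (drop (p * d) bits)) ` {..<s}
         else {})"

section \<open>The algorithm greedy-forward\<close>

definition best_candidate :: "(nat \<times> node) set \<Rightarrow> nat \<times> node" where
  "best_candidate X = (let c = Max (fst ` X) in (c, Max {i. (c, i) \<in> X}))"

fun stage_message ::
  "nat \<Rightarrow> nat \<Rightarrow> token set \<Rightarrow> 'f::{field,finite} stage \<Rightarrow> 'f message pmf" where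
  "stage_message d b K (Forwarding t) =
     map_pmf Tokens (pmf_of_set {S. S \<subseteq> K \<and> card S = min (b div d) (card K)})"
| "stage_message d b K (Flooding t cand) = return_pmf (Candidate (fst cand) (snd cand))"
| "stage_message d b K (Coding t s W) = map_pmf Coded (random_combination (coded_dim b d s) W)"
| "stage_message d b K Halted = return_pmf Silent"

text \<open>
  After flooding, every node knows the largest number of tokens under consideration at a single node
  and the identifier of such a node, hence also how many tokens that node is going to broadcast.  If
  that number is zero then no tokens remain to be broadcast.
\<close>

definition after_flooding ::
  "nat \<Rightarrow> nat \<Rightarrow> nat \<times> node \<Rightarrow> 'f::field local_state \<Rightarrow> 'f local_state" where
  "after_flooding d b cand st =
     (let s = min (b\<^sup>2 div d) (fst cand)
      in if fst cand = 0 then st\<lparr>stage := Halted\<rparr>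
         else st\<lparr>stage := Coding 0 s
                (if ident st = snd cand
                 then source_vecs b d (take s (sorted_list_of_set (considered st)))
                 else {})\<rparr>)"

definition greedy_receive ::
  "nat \<Rightarrow> nat \<Rightarrow> nat \<Rightarrow> 'f::field local_state \<Rightarrow> 'f message multiset \<Rightarrow> 'f local_state" where
  "greedy_receive len d b st M =
     (case stage st of
        Forwarding t \<Rightarrow>
          (let st' = st\<lparr>known := known st \<union> \<Union>{S. Tokens S \<in># M}\<rparr>
           in if Suc t < len then st'\<lparr>stage := Forwarding (Suc t)\<rparr>
              else st'\<lparr>stage := Flooding 0 (card (considered st'), ident st')\<rparr>)
      | Flooding t cand \<Rightarrow>
          (let cand' = best_candidate (insert cand {(c, i). Candidate c i \<in># M})
           in if Suc t < len then st\<lparr>stage := Flooding (Suc t) cand'\<rparr>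
              else after_flooding d b cand' st)
      | Coding t s W \<Rightarrow>
          (let W' = W \<union> {w. Coded w \<in># M}; D = decode b d s W'
           in if Suc t < len then st\<lparr>stage := Coding (Suc t) s W'\<rparr>
              else st\<lparr>known := known st \<union> D, removed := removed st \<union> D, stage := Forwarding 0\<rparr>)
      | Halted \<Rightarrow> st)"

text \<open>
  The parameter \<open>len\<close> is the length in rounds of each of the three stages of an iteration.
\<close>

definition greedy_forward ::
  "nat \<Rightarrow> nat \<Rightarrow> nat \<Rightarrow> ('f::{field,finite} local_state, 'f message) protocol" where
  "greedy_forward len d b =
     \<lparr>init_state = (\<lambda>v K. \<lparr>ident = v, known = K, removed = {}, stage = Forwarding 0\<rparr>),
      choose_message = (\<lambda>st. stage_message d b (considered st) (stage st)),
      receive_messages = greedy_receive len d b,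
      terminated = (\<lambda>st. stage st = Halted),
      learned = known\<rparr>"

end

theory Submission
  imports Defs
begin

text \<open>
  All nodes run through the stages in lockstep, and since a stage is at least \<open>n\<close> rounds long,
  flooding always ends in agreement on one leader.  A forwarding stage that starts with \<open>k\<close>
  tokens under consideration, \<open>g = b div d\<close> of which fit into a message, leaves some node with
  \<open>M = min k (sqrt (g * k))\<close> of them: as long as every node knows fewer than \<open>M\<close>, each edge out of the
  set of nodes knowing a given token enlarges that set with probability at least \<open>min 1 (g / M)\<close>, so
  after \<open>O(n)\<close> rounds every token would have reached a fraction \<open>min 1 (g / M)\<close> of the nodes, which is
  too much for nodes knowing fewer than \<open>M\<close> tokens.  In a coding stage the nodes holding a vector not
  orthogonal to a given nonzero coefficient vector spread in the same manner, with probability at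
  least \<open>1/2\<close> per round, and a union bound over all coefficient vectors shows that every node
  can decode.  Both are instances of one tail bound for growing sets, valid for every adaptive adversary.
  An iteration thus removes \<open>min (b\<^sup>2 div d) M\<close> tokens, and \<open>O(k * d / b\<^sup>2 + b)\<close> iterations suffice.
\<close>


section \<open>Iterated probability kernels\<close>

text \<open>Randomness affects only the speed. A node whose elimination is incomplete decodes
  nothing, so no wrong token is ever accepted; lockstep, agreement on a leader and message sizes
  hold with certainty, even after a bad iteration. The obstacle is the adaptive adversary: its
  graphs depend on all earlier messages, so rounds are not independent trials. What holds given any
  history is that some edge leaves the set to be grown, hence a supermartingale estimate conditional
  on the state. For forwarding even the growth rate is good only while nodes know few tokens; this
  condition, once lost, never returns, and so it can be built into the potential. The square root in
  \<open>M\<close> solves \<open>k * p = M\<close> with \<open>p = g / M\<close>. As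
  \<open>M \<le> g * sqrt k\<close>, the threshold \<open>card V * p\<close> is at least
  \<open>sqrt (card V)\<close>, and failures are exponentially small in
  \<open>sqrt (card V)\<close>, which absorbs the union bounds over tokens and iterations.
  Coefficient vectors are exponentially many; a coding stage of length proportional to
  \<open>CARD('f) * card V\<close> pays for them, which is why the constants depend on the
  field.\<close>

fun kernel_power :: "('x \<Rightarrow> 'x pmf) \<Rightarrow> nat \<Rightarrow> 'x \<Rightarrow> 'x pmf" where
  "kernel_power K 0 x = return_pmf x"
| "kernel_power K (Suc t) x = kernel_power K t x \<bind> K"

lemma kernel_power_add:
  "kernel_power K (s + t) x = kernel_power K s x \<bind> kernel_power K t"
proof (induction t)
  case 0
  then show ?case by (simp add: bind_return_pmf')
next
  case (Suc t)
  then show ?case by (simp add: bind_assoc_pmf)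
qed

lemma execution_eq_kernel_power:
  "execution P V I adv t =
     kernel_power (run_round P V adv) t ([], \<lambda>v. init_state P v (I v))"
  by (induction t) auto

lemma kernel_power_invariant:
  assumes "\<And>t x y. t < L \<Longrightarrow> Inv t x \<Longrightarrow> y \<in> set_pmf (K x) \<Longrightarrow> Inv (Suc t) y"
    and "Inv 0 x" and "y \<in> set_pmf (kernel_power K L x)"
  shows "Inv L y"
proof -
  have "t \<le> L \<Longrightarrow> y \<in> set_pmf (kernel_power K t x) \<Longrightarrow> Inv t y" for t y
  proof (induction t arbitrary: y)
    case 0
    then show ?case using assms(2) by simp
  next
    case (Suc t)
    then obtain z where "z \<in> set_pmf (kernel_power K t x)" "y \<in> set_pmf (K z)" by auto
    then show ?case using Suc assms(1)[of t z y] by simp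
  qed
  then show ?thesis using assms(3) by simp
qed

text \<open>Failures of consecutive stages add up: the second bound is demanded uniformly from the
  good outcomes of the first, so no independence between the stages is involved.\<close>

lemma prob_bind_le:
  assumes "measure_pmf.prob p (- G) \<le> e1" and "0 \<le> e2"
    and "\<And>x. x \<in> set_pmf p \<Longrightarrow> x \<in> G \<Longrightarrow> measure_pmf.prob (f x) A \<le> e2"
  shows "measure_pmf.prob (p \<bind> f) A \<le> e1 + e2"
proof -
  have e1: "0 \<le> e1" using assms(1) measure_nonneg order_trans by blast
  have "emeasure (bind_pmf p f) A = (\<integral>\<^sup>+x. emeasure (f x) A \<partial>p)" by simp
  also have "\<dots> \<le> (\<integral>\<^sup>+x. indicator (- G) x + ennreal e2 \<partial>p)"
  proof (rule nn_integral_mono_AE, subst AE_measure_pmf_iff, intro ballI)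
    fix x assume x: "x \<in> set_pmf p"
    show "emeasure (f x) A \<le> indicator (- G) x + ennreal e2"
    proof (cases "x \<in> G")
      case True
      then show ?thesis using assms(3)[OF x True]
        by (simp add: measure_pmf.emeasure_eq_measure ennreal_leI)
    next
      case False
      then show ?thesis
        by (simp add: measure_pmf.emeasure_eq_measure)
          (metis add_increasing2 ennreal_1 ennreal_leI measure_pmf.prob_le_1 zero_le)
    qed
  qed
  also have "\<dots> = emeasure p (- G) + ennreal e2"
    by (subst nn_integral_add) (auto simp: measure_pmf.emeasure_space_1)
  also have "\<dots> \<le> ennreal e1 + ennreal e2"
    using assms(1) by (simp add: measure_pmf.emeasure_eq_measure ennreal_leI add_right_mono)
  also have "\<dots> = ennreal (e1 + e2)" using e1 assms(2) by (simp add: ennreal_plus)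
  finally show ?thesis
    using e1 assms(2) by (simp add: measure_pmf.emeasure_eq_measure del: ennreal_plus)
qed

lemma prob_eq_0I:
  assumes "\<And>x. x \<in> set_pmf p \<Longrightarrow> x \<notin> A"
  shows "measure_pmf.prob p A = 0"
  using assms by (simp add: measure_pmf_zero_iff disjoint_iff)

text \<open>Only states satisfying the time-indexed invariant are reached, so a one-step contraction
  on those multiplies up. Extended nonnegative reals avoid all integrability conditions.\<close>

lemma kernel_power_supermartingale:
  fixes \<Phi> :: "'x \<Rightarrow> ennreal"
  assumes inv: "\<And>t x y. t < L \<Longrightarrow> Inv t x \<Longrightarrow> y \<in> set_pmf (K x) \<Longrightarrow> Inv (Suc t) y"
    and init: "Inv 0 x"
    and step: "\<And>t x. t < L \<Longrightarrow> Inv t x \<Longrightarrow> (\<integral>\<^sup>+y. \<Phi> y \<partial>K x) \<le> r * \<Phi> x"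
  shows "(\<integral>\<^sup>+y. \<Phi> y \<partial>kernel_power K L x) \<le> r ^ L * \<Phi> x"
proof -
  have "t \<le> L \<Longrightarrow> (\<integral>\<^sup>+y. \<Phi> y \<partial>kernel_power K t x) \<le> r ^ t * \<Phi> x" for t
  proof (induction t)
    case 0
    then show ?case by simp
  next
    case (Suc t)
    have Inv: "Inv t y" if "y \<in> set_pmf (kernel_power K t x)" for y
      using kernel_power_invariant[of t Inv K x y] inv init that Suc.prems by simp
    have "(\<integral>\<^sup>+y. \<Phi> y \<partial>kernel_power K (Suc t) x) =
        (\<integral>\<^sup>+z. \<integral>\<^sup>+y. \<Phi> y \<partial>K z \<partial>kernel_power K t x)" by simp
    also have "\<dots> \<le> (\<integral>\<^sup>+z. r * \<Phi> z \<partial>kernel_power K t x)"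
      using step[of t] Inv Suc.prems by (intro nn_integral_mono_AE) (simp add: AE_measure_pmf_iff)
    also have "\<dots> = r * (\<integral>\<^sup>+z. \<Phi> z \<partial>kernel_power K t x)"
      by (rule nn_integral_cmult) simp
    also have "\<dots> \<le> r * (r ^ t * \<Phi> x)"
      using Suc by (intro mult_left_mono) auto
    finally show ?case by (simp add: mult.assoc)
  qed
  then show ?thesis by simp
qed

text \<open>
  The potential \<open>2\<close> to the minus number of informed nodes, set to zero outside of the event \<open>E\<close>,
  shrinks in expectation by the factor \<open>1 - p/2\<close> in every round.
\<close>

lemma epidemic_tail_bound:
  fixes K :: "'x \<Rightarrow> 'x pmf" and Inf :: "'x \<Rightarrow> 'v set" and p m :: real
  assumes inv: "\<And>t x y. t < L \<Longrightarrow> Inv t x \<Longrightarrow> y \<in> set_pmf (K x) \<Longrightarrow> Inv (Suc t) y"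
    and init: "Inv 0 x"
    and V: "finite V" "\<And>x. Inf x \<subseteq> V"
    and mono: "\<And>t x y. t < L \<Longrightarrow> Inv t x \<Longrightarrow> y \<in> set_pmf (K x) \<Longrightarrow> Inf x \<subseteq> Inf y"
    and anti: "\<And>t x y. t < L \<Longrightarrow> Inv t x \<Longrightarrow> y \<in> set_pmf (K x) \<Longrightarrow> E y \<Longrightarrow> E x"
    and growth: "\<And>t x. t < L \<Longrightarrow> Inv t x \<Longrightarrow> E x \<Longrightarrow> Inf x \<noteq> V \<Longrightarrow>
      p \<le> measure_pmf.prob (K x) {y. Inf y \<noteq> Inf x}"
    and p: "0 \<le> p" "p \<le> 1" and m: "m \<le> card V"
  shows "measure_pmf.prob (kernel_power K L x) {y. E y \<and> card (Inf y) < m} \<le> exp (m - p * L / 2)"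
proof -
  define \<Phi> where "\<Phi> y = (if E y \<and> Inf y \<noteq> V then (1/2::real) ^ card (Inf y) else 0)" for y
  have fin: "finite (Inf y)" for y using V finite_subset by blast
  have step: "(\<integral>\<^sup>+y. \<Phi> y \<partial>K x) \<le> ennreal (1 - p/2) * \<Phi> x" if t: "t < L" "Inv t x" for t x
  proof (cases "E x \<and> Inf x \<noteq> V")
    \<comment> \<open>Outside of \<open>E\<close>, or with everyone informed, the potential stays
      zero: \<open>anti\<close> carries the failure of \<open>E\<close> forward and
      \<open>mono\<close> keeps all of \<open>V\<close> informed.\<close>
    case False
    have "\<Phi> y = 0" if "y \<in> set_pmf (K x)" for y
      using False mono[OF t that] anti[OF t that] V(2)[of y] by (auto simp: \<Phi>_def)
    then have "(\<integral>\<^sup>+y. \<Phi> y \<partial>K x) = 0"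
      by (subst nn_integral_0_iff_AE) (auto simp: AE_measure_pmf_iff)
    then show ?thesis by simp
  next
    case True
    let ?A = "{y. Inf y \<noteq> Inf x}"
    have phi: "\<Phi> x = (1/2) ^ card (Inf x)" using True by (simp add: \<Phi>_def)
    have "(\<integral>\<^sup>+y. \<Phi> y \<partial>K x) \<le> (\<integral>\<^sup>+y. ennreal (\<Phi> x) * (ennreal (1/2) * indicator ?A y + indicator (- ?A) y) \<partial>K x)"
    proof (rule nn_integral_mono_AE, subst AE_measure_pmf_iff, intro ballI)
      fix y assume y: "y \<in> set_pmf (K x)"
      have sub: "Inf x \<subseteq> Inf y" using mono[OF t y] .
      show "ennreal (\<Phi> y) \<le> ennreal (\<Phi> x) * (ennreal (1/2) * indicator ?A y + indicator (- ?A) y)"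
      proof (cases "Inf y = Inf x")
        case eq: True
        then show ?thesis using True by (simp add: \<Phi>_def)
      next
        case False
        \<comment> \<open>One new member halves the potential, so the mean factor is at most
          \<open>1/2 * q + (1 - q)\<close> with \<open>q \<ge> p\<close> the probability of
          growth.\<close>
        then have "card (Inf x) < card (Inf y)"
          using sub fin[of y] by (metis psubset_card_mono psubsetI)
        then have "(1/2::real) ^ card (Inf y) \<le> (1/2) ^ Suc (card (Inf x))"
          by (intro power_decreasing) auto
        then have "\<Phi> y \<le> \<Phi> x * (1/2)" using True by (auto simp: \<Phi>_def)
        then have "ennreal (\<Phi> y) \<le> ennreal (\<Phi> x * (1/2))" by (rule ennreal_leI)
        also have "\<dots> = ennreal (\<Phi> x) * ennreal (1/2)"
          by (rule ennreal_mult) (auto simp: \<Phi>_def)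
        finally show ?thesis using False by simp
      qed
    qed
    also have "\<dots> = ennreal (\<Phi> x) * (ennreal (1/2) * emeasure (K x) ?A + emeasure (K x) (- ?A))"
      by (subst nn_integral_cmult, simp, subst nn_integral_add) (auto simp: nn_integral_cmult)
    also have "\<dots> = ennreal (\<Phi> x) * ennreal (1/2 * measure_pmf.prob (K x) ?A + measure_pmf.prob (K x) (- ?A))"
      unfolding measure_pmf.emeasure_eq_measure
      by (subst ennreal_plus, simp, simp, subst ennreal_mult) auto
    also have "measure_pmf.prob (K x) (- ?A) = 1 - measure_pmf.prob (K x) ?A"
      using measure_pmf.prob_compl[of ?A "K x"] by (simp add: Compl_eq_Diff_UNIV)
    also have "ennreal (\<Phi> x) * ennreal (1/2 * measure_pmf.prob (K x) ?A + (1 - measure_pmf.prob (K x) ?A))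
        \<le> ennreal (\<Phi> x) * ennreal (1 - p/2)"
      using growth[OF t] True by (intro mult_left_mono ennreal_leI) auto
    finally show ?thesis by (simp add: mult.commute)
  qed
  have "(\<integral>\<^sup>+y. \<Phi> y \<partial>kernel_power K L x) \<le> ennreal (1 - p/2) ^ L * \<Phi> x"
    by (rule kernel_power_supermartingale[where Inv = Inv and \<Phi> = "\<lambda>y. ennreal (\<Phi> y)"])
      (fact inv init step)+
  also have "\<dots> \<le> ennreal (1 - p/2) ^ L * ennreal 1"
    by (intro mult_left_mono ennreal_leI) (auto simp: \<Phi>_def power_le_one)
  also have "\<dots> = ennreal ((1 - p/2) ^ L)" using p by (simp add: ennreal_power)
  finally have int: "(\<integral>\<^sup>+y. \<Phi> y \<partial>kernel_power K L x) \<le> ennreal ((1 - p/2) ^ L)" .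
  let ?B = "{y. E y \<and> card (Inf y) < m}"
  \<comment> \<open>Markov's inequality: on the bad event the potential is at least
    \<open>exp (- m)\<close>.\<close>
  have "ennreal (exp (- m)) * indicator ?B y \<le> ennreal (\<Phi> y)" for y
  proof (cases "y \<in> ?B")
    case True
    have "exp (- m) \<le> exp (- real (card (Inf y)))" using True by simp
    also have "\<dots> = (exp (-1)) ^ card (Inf y)" by (simp flip: exp_of_nat_mult)
    also have "\<dots> \<le> (1/2) ^ card (Inf y)"
    proof (rule power_mono)
      have "2 \<le> exp (1::real)" using exp_ge_add_one_self[of 1] by simp
      then show "exp (-1) \<le> (1/2::real)" by (simp add: exp_minus field_simps)
    qed simp
    \<comment> \<open>A count below \<open>m \<le> card V\<close> rules out
      \<open>Inf y = V\<close>, the case in which the potential was set to zero.\<close>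
    also have "\<dots> = \<Phi> y" using True m by (auto simp: \<Phi>_def)
    finally show ?thesis using True by (simp add: ennreal_leI)
  qed simp
  then have "(\<integral>\<^sup>+y. ennreal (exp (- m)) * indicator ?B y \<partial>kernel_power K L x)
      \<le> (\<integral>\<^sup>+y. \<Phi> y \<partial>kernel_power K L x)"
    by (intro nn_integral_mono) auto
  then have "ennreal (exp (- m)) * emeasure (kernel_power K L x) ?B \<le> ennreal ((1 - p/2) ^ L)"
    using int by (simp add: nn_integral_cmult)
  then have "ennreal (exp (- m) * measure_pmf.prob (kernel_power K L x) ?B) \<le> ennreal ((1 - p/2) ^ L)"
    by (simp add: measure_pmf.emeasure_eq_measure ennreal_mult)
  then have "exp (- m) * measure_pmf.prob (kernel_power K L x) ?B \<le> (1 - p/2) ^ L"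
    using p by (subst (asm) ennreal_le_iff) auto
  also have "\<dots> \<le> exp (- p/2) ^ L"
    using exp_ge_add_one_self[of "- p/2"] p by (intro power_mono) auto
  also have "\<dots> = exp (- (p * L / 2))" by (simp flip: exp_of_nat_mult add: mult.commute)
  finally have "exp m * (exp (- m) * measure_pmf.prob (kernel_power K L x) ?B) \<le> exp m * exp (- (p * L / 2))"
    by (intro mult_left_mono) auto
  moreover have "exp m * (exp (- m) * q) = q" for q
    by (simp flip: mult.assoc exp_add)
  moreover have "exp m * exp (- (p * L / 2)) = exp (m - p * L / 2)" by (simp flip: exp_add)
  ultimately show ?thesis by simp
qed


section \<open>Coded vectors and decoding\<close>

text \<open>The linear span of the source vectors, given by equations: the payload of
  \<open>w\<close> is determined by its leading entries, read as coefficients.\<close>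

definition consistent :: "nat \<Rightarrow> nat \<Rightarrow> token list \<Rightarrow> 'f::field vec \<Rightarrow> bool" where
  "consistent b d xs w \<longleftrightarrow>
     dim_vec w = coded_dim b d (length xs) \<and>
     (\<forall>j<block_bits b d. w $ (num_blocks b d (length xs) + j) =
        (\<Sum>i<num_blocks b d (length xs). w $ i * block_vec b d xs i $ j))"

text \<open>The dual view of rank: the coefficient parts of \<open>W\<close> span the whole
  \<open>m\<close>-dimensional space exactly when every nonzero \<open>\<mu>\<close> is sensed.
  Unlike rank, sensing one fixed \<open>\<mu>\<close> is a yes-or-no property that spreads like a
  rumour.\<close>

definition senses :: "nat \<Rightarrow> (nat \<Rightarrow> 'f::field) \<Rightarrow> 'f vec set \<Rightarrow> bool" where
  "senses m \<mu> W \<longleftrightarrow> (\<exists>w\<in>W. (\<Sum>i<m. \<mu> i * w $ i) \<noteq> 0)"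

lemma sum_of_bool_eq_mult:
  fixes f :: "nat \<Rightarrow> 'a::semiring_1"
  assumes "i < m"
  shows "(\<Sum>j<m. of_bool (j = i) * f j) = f i" "(\<Sum>j<m. f j * of_bool (j = i)) = f i"
  using assms by (simp_all add: of_bool_def if_distrib[of "\<lambda>x. x * _"] if_distrib[of "\<lambda>x. _ * x"] cong: if_cong)

lemma finite_source_vecs: "finite (source_vecs b d xs)"
  by (simp add: source_vecs_def Let_def)

lemma source_vecs_consistent:
  assumes "w \<in> source_vecs b d xs"
  shows "consistent b d xs w"
proof -
  let ?m = "num_blocks b d (length xs)"
  obtain i where i: "i < ?m" "w = unit_vec ?m i @\<^sub>v block_vec b d xs i"
    using assms by (auto simp: source_vecs_def Let_def)
  have "(\<Sum>j<?m. w $ j * block_vec b d xs j $ l) = block_vec b d xs i $ l" if "l < block_bits b d" for l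
  proof -
    have "(\<Sum>j<?m. w $ j * block_vec b d xs j $ l) = (\<Sum>j<?m. of_bool (j = i) * block_vec b d xs j $ l)"
      using i by (intro sum.cong) (auto simp: unit_vec_def of_bool_def)
    then show ?thesis using sum_of_bool_eq_mult(1)[OF i(1)] by simp
  qed
  then show ?thesis using i by (simp add: consistent_def coded_dim_def block_vec_def Let_def)
qed

lemma source_vecs_senses:
  assumes "i < num_blocks b d (length xs)" and "\<mu> i \<noteq> 0"
  shows "senses (num_blocks b d (length xs)) \<mu> (source_vecs b d xs)"
proof -
  let ?m = "num_blocks b d (length xs)"
  let ?w = "unit_vec ?m i @\<^sub>v block_vec b d xs i :: 'a vec"
  have "(\<Sum>j<?m. \<mu> j * ?w $ j) = (\<Sum>j<?m. \<mu> j * of_bool (j = i))"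
    using assms by (intro sum.cong) (auto simp: unit_vec_def of_bool_def)
  also have "\<dots> = \<mu> i" using sum_of_bool_eq_mult(2)[OF assms(1)] by simp
  finally have "(\<Sum>j<?m. \<mu> j * ?w $ j) \<noteq> 0" using assms(2) by simp
  moreover have "?w \<in> source_vecs b d xs" using assms(1) by (simp add: source_vecs_def Let_def)
  ultimately show ?thesis unfolding senses_def by blast
qed

lemma consistent_combination:
  fixes w :: "'f::field vec"
  assumes W: "\<And>u. u \<in> W \<Longrightarrow> consistent b d xs u"
    and w: "dim_vec w = coded_dim b d (length xs)"
      "\<And>j. j < coded_dim b d (length xs) \<Longrightarrow> w $ j = (\<Sum>u\<in>W. c u * u $ j)"
  shows "consistent b d xs w"
proof -
  let ?m = "num_blocks b d (length xs)"
  have "w $ (?m + j) = (\<Sum>i<?m. w $ i * block_vec b d xs i $ j)" if j: "j < block_bits b d" for j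
  proof -
    have "w $ (?m + j) = (\<Sum>u\<in>W. c u * u $ (?m + j))"
      using w j by (simp add: coded_dim_def)
    also have "\<dots> = (\<Sum>u\<in>W. \<Sum>i<?m. c u * u $ i * block_vec b d xs i $ j)"
      using W j by (intro sum.cong) (auto simp: consistent_def sum_distrib_left mult.assoc)
    also have "\<dots> = (\<Sum>i<?m. (\<Sum>u\<in>W. c u * u $ i) * block_vec b d xs i $ j)"
      by (subst sum.swap) (simp add: sum_distrib_right)
    also have "\<dots> = (\<Sum>i<?m. w $ i * block_vec b d xs i $ j)"
      using w by (intro sum.cong) (auto simp: coded_dim_def)
    finally show ?thesis .
  qed
  then show ?thesis using w by (simp add: consistent_def)
qed

lemma random_combination_support:
  assumes "w \<in> set_pmf (random_combination l W)"
  shows "\<exists>c. w = vec l (\<lambda>j. \<Sum>u\<in>W. c u * u $ j)"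
  using assms by (auto simp: random_combination_def)

lemma linear_form_vanishes_prob:
  fixes a :: "'i \<Rightarrow> 'f::{field,finite}"
  assumes W: "finite W" and w0: "w0 \<in> W" "a w0 \<noteq> 0"
  shows "measure_pmf.prob (Pi_pmf W 0 (\<lambda>_. pmf_of_set UNIV)) {c. (\<Sum>w\<in>W. c w * a w) \<noteq> 0} \<ge> 1/2"
proof -
  define S where "S = PiE_dflt W 0 (\<lambda>_. UNIV :: 'f set)"
  let ?A = "{c. (\<Sum>w\<in>W. c w * a w) \<noteq> 0}"
  have S: "finite S" "S \<noteq> {}" using W by (auto simp: S_def)
  \<comment> \<open>Raising the coefficient of \<open>w0\<close> by one changes the form by
    \<open>a w0 \<noteq> 0\<close>, so its zeros inject into its nonzeros. This gives 1/2 for every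
    field size.\<close>
  let ?g = "\<lambda>c. c(w0 := c w0 + 1)"
  have "(\<Sum>w\<in>W. (?g c) w * a w) = (\<Sum>w\<in>W. c w * a w) + a w0" for c
    using W w0 by (simp add: sum.remove[of W w0] distrib_right)
  then have "?g ` (S - ?A) \<subseteq> S \<inter> ?A"
    using w0 by (auto simp: S_def PiE_dflt_def split: if_splits)
  moreover have "inj_on ?g (S - ?A)"
    by (rule inj_onI, rule ext) (metis add_right_cancel fun_upd_apply)
  ultimately have "card (S - ?A) \<le> card (S \<inter> ?A)"
    using S by (intro card_inj_on_le) auto
  moreover have "card S = card (S \<inter> ?A) + card (S - ?A)"
    using S(1) by (rule card_Int_Diff)
  moreover have "card S > 0" using S by (simp add: card_gt_0_iff)
  moreover have half: "1/2 \<le> real x / real z" if "y \<le> x" "z = x + y" "0 < z" for x y z :: nat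
  proof -
    have "real y \<le> real x" "real z = real x + real y" "0 < real z" using that by auto
    then show ?thesis by (subst pos_le_divide_eq) linarith+
  qed
  ultimately have "1/2 \<le> real (card (S \<inter> ?A)) / card S"
    by (intro half)
  moreover have "Pi_pmf W 0 (\<lambda>_. pmf_of_set UNIV) = pmf_of_set S"
    unfolding S_def by (rule Pi_pmf_of_set) (use W in auto)
  ultimately show ?thesis using S by (simp add: measure_pmf_of_set)
qed

lemma random_combination_senses:
  fixes W :: "'f::{field,finite} vec set"
  assumes W: "finite W" "senses m \<mu> W" and "m \<le> l"
  shows "measure_pmf.prob (random_combination l W) {w. (\<Sum>i<m. \<mu> i * w $ i) \<noteq> 0} \<ge> 1/2"
proof -
  obtain w0 where w0: "w0 \<in> W" "(\<Sum>i<m. \<mu> i * w0 $ i) \<noteq> 0" using W by (auto simp: senses_def)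
  have "(\<Sum>i<m. \<mu> i * vec l (\<lambda>j. \<Sum>w\<in>W. c w * w $ j) $ i) = (\<Sum>w\<in>W. c w * (\<Sum>i<m. \<mu> i * w $ i))" for c
  proof -
    have "(\<Sum>i<m. \<mu> i * vec l (\<lambda>j. \<Sum>w\<in>W. c w * w $ j) $ i) = (\<Sum>i<m. \<Sum>w\<in>W. c w * (\<mu> i * w $ i))"
      using assms(3) by (intro sum.cong) (auto simp: sum_distrib_left mult.left_commute)
    then show ?thesis by (subst (asm) sum.swap) (simp add: sum_distrib_left)
  qed
  then show ?thesis
    using linear_form_vanishes_prob[of W w0 "\<lambda>w. \<Sum>i<m. \<mu> i * w $ i"] W w0
    by (simp add: random_combination_def vimage_def)
qed

text \<open>The kernel condition says that the first \<open>m\<close> columns are linearly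
  independent, and independent leading columns of a reduced echelon form must all be pivot columns,
  in order.\<close>

lemma row_echelon_leading_identity:
  fixes C :: "'f::field mat"
  assumes C: "C \<in> carrier_mat nr nc" and ref: "row_echelon_form C" and m: "m \<le> nc"
    and inj: "\<And>x i. x \<in> carrier_vec nc \<Longrightarrow> C *\<^sub>v x = 0\<^sub>v nr \<Longrightarrow> (\<And>j. m \<le> j \<Longrightarrow> j < nc \<Longrightarrow> x $ j = 0)
        \<Longrightarrow> i < m \<Longrightarrow> x $ i = 0"
  shows "m \<le> nr" and "\<forall>i<m. \<forall>j<m. C $$ (i, j) = (if i = j then 1 else 0)"
proof -
  obtain f where "pivot_fun C f (dim_col C)" using ref by (auto simp: row_echelon_form_def)
  then have f: "pivot_fun C f nc" using C by auto
  have dim: "dim_row C = nr" using C by auto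
  note piv = pivot_funD[OF dim f]
  have f_mono: "f (i + l) = nc \<or> l + f i \<le> f (i + l)" if "i + l < nr" for i l
    using pivot_bound[OF dim f] that by blast
  have main: "i < nr \<and> f i = i" if "i < m" for i
    using that
  proof (induction i rule: less_induct)
    case (less i)
    have IH: "j < nr" "f j = j" if "j < i" for j using less that by auto
    show ?case
    proof (rule ccontr)
      assume neg: "\<not> (i < nr \<and> f i = i)"
      have zero: "C $$ (r, i) = 0" if r: "i \<le> r" "r < nr" for r
      proof -
        have "i < f i"
        proof -
          have ir: "i < nr" using r by simp
          have "f i \<ge> i"
          proof (cases i)
            case (Suc i')
            then show ?thesis using piv(3)[of i'] IH[of i'] ir less.prems m by auto
          qed simp
          then show ?thesis using neg ir by auto
        qed
        then have "i < f r" using f_mono[of i "r - i"] r less.prems m by auto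
        then show ?thesis using piv(2) r by blast
      qed
      \<comment> \<open>Column \<open>i\<close> would be a combination of the pivot columns before
        it; \<open>x\<close> records this relation and lies in the kernel although
        \<open>x $ i = 1\<close>.\<close>
      define x where "x = vec nc (\<lambda>j. if j = i then 1 else if j < i then - C $$ (j, i) else 0)"
      have "C *\<^sub>v x = 0\<^sub>v nr"
      proof (rule eq_vecI)
        fix r assume "r < dim_vec (0\<^sub>v nr :: 'f vec)"
        then have r: "r < nr" by simp
        have inc: "i < nc" using less.prems m by simp
        have "(C *\<^sub>v x) $ r = (\<Sum>j<nc. C $$ (r, j) * x $ j)"
          using C r by (simp add: scalar_prod_def x_def lessThan_atLeast0)
        also have "\<dots> = (\<Sum>j<Suc i. C $$ (r, j) * x $ j)"
          using inc by (intro sum.mono_neutral_right) (auto simp: x_def)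
        also have "\<dots> = C $$ (r, i) + (\<Sum>j<i. C $$ (r, j) * x $ j)"
          using inc by (simp add: x_def)
        also have "(\<Sum>j<i. C $$ (r, j) * x $ j) = (\<Sum>j<i. of_bool (j = r) * - C $$ (j, i))"
        proof (rule sum.cong)
          fix j assume "j \<in> {..<i}"
          then have j: "j < i" "j < nc" using inc by auto
          have "C $$ (r, j) = of_bool (j = r)"
            using piv(4)[of j] piv(5)[of j r] IH[OF j(1)] j r by auto
          then show "C $$ (r, j) * x $ j = of_bool (j = r) * - C $$ (j, i)"
            using j by (simp add: x_def)
        qed simp
        also have "C $$ (r, i) + \<dots> = 0"
        proof (cases "r < i")
          case True
          then show ?thesis using sum_of_bool_eq_mult(1)[OF True, of "\<lambda>j. - C $$ (j, i)"] by simp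
        next
          case False
          then have "(\<Sum>j<i. of_bool (j = r) * - C $$ (j, i)) = 0" by (intro sum.neutral) auto
          then show ?thesis using zero[of r] r False by simp
        qed
        finally show "(C *\<^sub>v x) $ r = 0\<^sub>v nr $ r" using r by simp
      qed (use C in auto)
      moreover have "x \<in> carrier_vec nc" by (simp add: x_def)
      ultimately have "x $ i = 0"
        using inj[of x i] less.prems by (simp add: x_def)
      then show False using less.prems m by (simp add: x_def)
    qed
  qed
  \<comment> \<open>For \<open>nr < m\<close> the claim \<open>main\<close> at \<open>i = nr\<close>
    would give \<open>nr < nr\<close>.\<close>
  then show "m \<le> nr" by (meson leI less_irrefl)
  show "\<forall>i<m. \<forall>j<m. C $$ (i, j) = (if i = j then 1 else 0)"
  proof (intro allI impI)
    fix i j assume ij: "i < m" "j < m"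
    then show "C $$ (i, j) = (if i = j then 1 else 0)"
      using main[of i] main[of j] piv(4)[of j] piv(5)[of j i] m by auto
  qed
qed

section \<open>Packing tokens into blocks, and decoding\<close>

lemma num_blocks_bounds:
  assumes "1 \<le> d" "d \<le> b"
  shows "s \<le> num_blocks b d s * (b div d)" and "num_blocks b d s \<le> s"
    and "1 \<le> s \<Longrightarrow> 1 \<le> num_blocks b d s"
proof -
  have g: "1 \<le> b div d" using assms by (simp add: div_greater_zero_iff Suc_leI)
  let ?q = "real s / real (b div d)"
  have "?q \<le> num_blocks b d s" by (simp add: num_blocks_def real_nat_ceiling_ge)
  then have "real s \<le> real (num_blocks b d s * (b div d))" using g by (simp add: field_simps)
  then show "s \<le> num_blocks b d s * (b div d)" using of_nat_le_iff by blast
  then show "1 \<le> s \<Longrightarrow> 1 \<le> num_blocks b d s" by (cases "num_blocks b d s") auto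
  have "?q \<le> real s" using g by (simp add: divide_le_eq mult_le_cancel_left1)
  then have "\<lceil>?q\<rceil> \<le> int s" by (simp add: ceiling_le_iff)
  then show "num_blocks b d s \<le> s" by (simp add: num_blocks_def nat_le_iff)
qed

lemma take_drop_concat:
  assumes "\<And>x. x \<in> set xs \<Longrightarrow> length x = d" and "p < length xs"
  shows "take d (drop (p * d) (concat xs @ ys)) = xs ! p"
  using assms
proof (induction xs arbitrary: p)
  case (Cons x xs)
  then show ?case by (cases p) auto
qed simp

lemma concat_map_blocks:
  "concat (map (\<lambda>i. map (\<lambda>j. f (i * B + j)) [0..<B]) [0..<m]) = map f [0..<m * B]"
proof (induction m)
  case (Suc m)
  have "[0..<Suc m * B] = [0..<m * B] @ map ((+) (m * B)) [0..<B]"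
  proof -
    have "map ((+) (m * B)) [0..<B] = [m * B..<m * B + B]" by (rule nth_equalityI) simp_all
    then show ?thesis using upt_add_eq_append[of 0 "m * B" B] by (simp add: add.commute)
  qed
  then show ?case using Suc by simp
qed simp

text \<open>The padding zeros follow the last token, so cutting at multiples of \<open>d\<close> for
  the \<open>length xs\<close> positions never reaches them; testing against 1 recovers the bits
  because \<open>0 \<noteq> 1\<close> in a field.\<close>

lemma decode_blocks:
  assumes d: "1 \<le> d" "d \<le> b" and len: "\<And>x. x \<in> set xs \<Longrightarrow> length x = d"
  shows "(\<lambda>p. take d (drop (p * d) (concat (map (\<lambda>i. map (\<lambda>j. block_vec b d xs i $ j = (1::'f::field))
             [0..<block_bits b d]) [0..<num_blocks b d (length xs)])))) ` {..<length xs} = set xs"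
proof -
  let ?m = "num_blocks b d (length xs)"
  let ?B = "block_bits b d"
  let ?f = "\<lambda>p. p < length (concat xs) \<and> concat xs ! p"
  have "concat (map (\<lambda>i. map (\<lambda>j. block_vec b d xs i $ j = (1::'f)) [0..<?B]) [0..<?m])
      = concat (map (\<lambda>i. map (\<lambda>j. ?f (i * ?B + j)) [0..<?B]) [0..<?m])"
    by (intro arg_cong[of _ _ concat] map_cong) (auto simp: block_vec_def Let_def)
  also have "\<dots> = map ?f [0..<?m * ?B]" by (rule concat_map_blocks)
  also have "\<dots> = concat xs @ replicate (?m * ?B - length (concat xs)) False"
  proof -
    have "length (concat xs) = length xs * d"
      using len by (induction xs) auto
    moreover have "length xs * d \<le> ?m * ?B"
      using mult_le_mono1[OF num_blocks_bounds(1)[OF d, of "length xs"], of d] by (simp add: block_bits_def mult.assoc)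
    ultimately show ?thesis by (intro nth_equalityI) (auto simp: nth_append)
  qed
  finally have eq: "concat (map (\<lambda>i. map (\<lambda>j. block_vec b d xs i $ j = (1::'f)) [0..<?B]) [0..<?m]) = \<dots>" .
  have "(\<lambda>p. take d (drop (p * d) (concat xs @ replicate (?m * ?B - length (concat xs)) False))) ` {..<length xs}
      = (!) xs ` {..<length xs}"
    by (intro image_cong refl take_drop_concat[OF len]) auto
  then show ?thesis unfolding eq by (simp add: nth_image lessThan_atLeast0)
qed

text \<open>Row operations stay within the span of the source vectors, so once the coefficient part
  is the identity, row \<open>i\<close> can only be source vector \<open>i\<close>. Hence decoding
  is all or nothing and never yields a wrong token; sensing every nonzero coefficient vector rules
  out an incomplete elimination.\<close>

lemma decode_consistent:
  fixes W :: "'f::field vec set"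
  assumes d: "1 \<le> d" "d \<le> b" and len: "\<And>x. x \<in> set xs \<Longrightarrow> length x = d"
    and W: "finite W" "\<And>w. w \<in> W \<Longrightarrow> consistent b d xs w"
  shows "decode b d (length xs) W \<in> {{}, set xs}"
    and "(\<And>\<mu> i. i < num_blocks b d (length xs) \<Longrightarrow> \<mu> i \<noteq> 0 \<Longrightarrow> senses (num_blocks b d (length xs)) \<mu> W) \<Longrightarrow>
      decode b d (length xs) W = set xs"
proof -
  let ?m = "num_blocks b d (length xs)"
  let ?B = "block_bits b d"
  let ?l = "coded_dim b d (length xs)"
  define ws where "ws = (SOME ws. set ws = W \<and> distinct ws)"
  have ws: "set ws = W" "distinct ws"
    using someI_ex[OF finite_distinct_list[OF W(1)]] by (auto simp: ws_def)
  let ?A = "mat_of_rows ?l ws"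
  define C where "C = gauss_jordan_single ?A"
  let ?nr = "length ws"
  have A: "?A \<in> carrier_mat ?nr ?l" by simp
  note gj = gauss_jordan_single[OF A C_def[symmetric]]
  have Cdim: "dim_row C = ?nr" "dim_col C = ?l" using gj(2) by auto
  obtain P where P: "C = P * ?A" "P \<in> carrier_mat ?nr ?nr" using gj(4) by blast
  have wsdim: "dim_vec (ws ! i) = ?l" if "i < ?nr" for i
    using that ws W(2) by (metis consistent_def nth_mem)
  have A_index: "?A $$ (i, j) = ws ! i $ j" if "i < ?nr" "j < ?l" for i j
    using that by (simp add: mat_of_rows_def)
  have rowC: "consistent b d xs (row C r)" if r: "r < ?nr" for r
  proof (rule consistent_combination)
    show "consistent b d xs u" if "u \<in> W" for u using W that by blast
    show "dim_vec (row C r) = ?l" using Cdim by simp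
    fix j assume j: "j < ?l"
    have "row C r $ j = (\<Sum>k<?nr. P $$ (r, k) * ws ! k $ j)"
      using P r j A_index by (simp add: Cdim(2)[unfolded P] scalar_prod_def lessThan_atLeast0)
    \<comment> \<open>Indices are traded for vectors through the inverse of the distinct list
      \<open>ws\<close>, since \<open>consistent_combination\<close> sums over a set.\<close>
    also have "\<dots> = (\<Sum>k<?nr. P $$ (r, the_inv_into {..<?nr} ((!) ws) (ws ! k)) * ws ! k $ j)"
      using ws(2) by (intro sum.cong) (auto simp: the_inv_into_f_f inj_on_nth)
    also have "\<dots> = (\<Sum>u\<in>W. P $$ (r, the_inv_into {..<?nr} ((!) ws) u) * u $ j)"
    proof -
      have "bij_betw ((!) ws) {..<?nr} W" using bij_betw_nth[OF ws(2) refl ws(1)[symmetric]] .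
      then show ?thesis by (rule sum.reindex_bij_betw)
    qed
    finally show "row C r $ j = \<dots>" .
  qed
  have D: "decode b d (length xs) W =
      (if ?m \<le> ?nr \<and> (\<forall>i<?m. \<forall>j<?m. C $$ (i, j) = (if i = j then 1 else 0)) then set xs else {})"
  proof (cases "?m \<le> ?nr \<and> (\<forall>i<?m. \<forall>j<?m. C $$ (i, j) = (if i = j then 1 else 0))")
    case False
    have "decode b d (length xs) W = {}"
      unfolding decode_def Let_def ws_def[symmetric] C_def[symmetric] Cdim by (rule if_not_P[OF False])
    then show ?thesis by (simp only: if_not_P[OF False])
  next
    case True
    have entry: "C $$ (i, ?m + j) = block_vec b d xs i $ j" if ij: "i < ?m" "j < ?B" for i j
    proof -
      have i: "i < ?nr" using True ij by simp
      have lm: "?m + j < ?l" "\<And>k. k < ?m \<Longrightarrow> k < ?l" using ij by (auto simp: coded_dim_def)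
      have "C $$ (i, ?m + j) = row C i $ (?m + j)" using i lm Cdim by simp
      also have "\<dots> = (\<Sum>k<?m. row C i $ k * block_vec b d xs k $ j)"
        using rowC[OF i] ij by (simp add: consistent_def)
      also have "\<dots> = (\<Sum>k<?m. of_bool (k = i) * block_vec b d xs k $ j)"
        using True ij i lm Cdim by (intro sum.cong) auto
      also have "\<dots> = block_vec b d xs i $ j" using sum_of_bool_eq_mult(1)[OF ij(1)] .
      finally show ?thesis .
    qed
    have bits: "concat (map (\<lambda>i. map (\<lambda>j. C $$ (i, ?m + j) = 1) [0..<?B]) [0..<?m]) =
        concat (map (\<lambda>i. map (\<lambda>j. block_vec b d xs i $ j = (1::'f)) [0..<?B]) [0..<?m])"
      by (intro arg_cong[of _ _ concat] map_cong refl) (simp add: entry)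
    have "decode b d (length xs) W = (\<lambda>p. take d (drop (p * d)
        (concat (map (\<lambda>i. map (\<lambda>j. C $$ (i, ?m + j) = 1) [0..<?B]) [0..<?m])))) ` {..<length xs}"
      unfolding decode_def Let_def ws_def[symmetric] C_def[symmetric] Cdim by (rule if_P[OF True])
    also have "\<dots> = set xs" unfolding bits by (rule decode_blocks[OF d len])
    finally have "decode b d (length xs) W = set xs" .
    then show ?thesis by (simp only: if_P[OF True])
  qed
  then show "decode b d (length xs) W \<in> {{}, set xs}" by simp
  assume sens: "\<And>\<mu> i. i < ?m \<Longrightarrow> \<mu> i \<noteq> 0 \<Longrightarrow> senses ?m \<mu> W"
  have ml: "?m \<le> ?l" by (simp add: coded_dim_def)
  \<comment> \<open>Elimination preserves the kernel, so a nonzero kernel vector supported on the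
    coefficient columns would be a \<open>\<mu>\<close> orthogonal to every held vector.\<close>
  have inj: "x $ i = 0" if x: "x \<in> carrier_vec ?l" "C *\<^sub>v x = 0\<^sub>v ?nr"
      "\<And>j. ?m \<le> j \<Longrightarrow> j < ?l \<Longrightarrow> x $ j = 0" "i < ?m" for x i
  proof (rule ccontr)
    assume "x $ i \<noteq> 0"
    then obtain w where w: "w \<in> W" "(\<Sum>i<?m. x $ i * w $ i) \<noteq> 0"
      using sens[of i "\<lambda>i. x $ i"] x by (auto simp: senses_def)
    then obtain k where k: "k < ?nr" "w = ws ! k" using ws by (metis in_set_conv_nth)
    have "?A *\<^sub>v x = 0\<^sub>v ?nr" using gj(1)[OF x(1)] x(2) by simp
    then have "0 = (?A *\<^sub>v x) $ k" using k by simp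
    also have "\<dots> = (\<Sum>j<?l. ws ! k $ j * x $ j)"
      using k x A_index by (simp add: scalar_prod_def lessThan_atLeast0)
    also have "\<dots> = (\<Sum>j<?m. ws ! k $ j * x $ j)"
      using ml x by (intro sum.mono_neutral_right) auto
    finally show False using w k by (simp add: mult.commute)
  qed
  show "decode b d (length xs) W = set xs"
    unfolding D
  proof (rule if_P, rule conjI)
    show "?m \<le> ?nr" by (rule row_echelon_leading_identity(1)[OF gj(2,3) ml]) (fact inj)
    show "\<forall>i<?m. \<forall>j<?m. C $$ (i, j) = (if i = j then 1 else 0)"
      by (rule row_echelon_leading_identity(2)[OF gj(2,3) ml]) (fact inj)
  qed
qed


section \<open>Stages of greedy-forward\<close>

lemma best_candidate_mem:
  assumes "finite X" "X \<noteq> {}"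
  shows "best_candidate X \<in> X"
proof -
  have "Max (fst ` X) \<in> fst ` X" using assms by simp
  then have "{i. (Max (fst ` X), i) \<in> X} \<noteq> {}" by force
  moreover have "finite {i. (Max (fst ` X), i) \<in> X}"
    by (rule finite_subset[of _ "snd ` X"]) (use assms in force)+
  ultimately have "Max {i. (Max (fst ` X), i) \<in> X} \<in> {i. (Max (fst ` X), i) \<in> X}"
    by (rule Max_in[rotated])
  then show ?thesis by (simp add: best_candidate_def Let_def)
qed

lemma fst_best_candidate: "fst (best_candidate X) = Max (fst ` X)"
  by (simp add: best_candidate_def Let_def)

text \<open>A node that hears the globally best candidate adopts it whatever else it hears. Breaking
  ties by the identifier makes the winner a single node.\<close>

lemma best_candidate_subset:
  assumes Y: "finite Y" and X: "X \<subseteq> Y" "best_candidate Y \<in> X"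
  shows "best_candidate X = best_candidate Y"
proof -
  have finX: "finite X" using X Y finite_subset by blast
  have 1: "Max (fst ` X) = Max (fst ` Y)"
  proof (rule antisym)
    show "Max (fst ` X) \<le> Max (fst ` Y)" using X Y by (intro Max_mono) auto
    show "Max (fst ` Y) \<le> Max (fst ` X)"
      using X finX by (metis Max_ge finite_imageI fst_best_candidate image_eqI)
  qed
  let ?f = "\<lambda>Z. {i. (Max (fst ` Y), i) \<in> Z}"
  have finY: "finite (?f Y)" by (rule finite_subset[of _ "snd ` Y"]) (use Y in force)+
  have sub: "?f X \<subseteq> ?f Y" using X by auto
  have mem: "Max (?f Y) \<in> ?f X" using X(2) by (simp add: best_candidate_def Let_def)
  have "Max (?f X) = Max (?f Y)"
  proof (rule antisym)
    show "Max (?f X) \<le> Max (?f Y)" using mem sub finY by (intro Max_mono) blast+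
    show "Max (?f Y) \<le> Max (?f X)" using mem finite_subset[OF sub finY] by (rule Max_ge[rotated])
  qed
  then show ?thesis using 1 by (simp add: best_candidate_def Let_def)
qed

text \<open>A path from inside to outside must leave the set somewhere. This one edge per round is
  all that the adversary must grant to a growing set.\<close>

lemma connected_graph_boundary_edge:
  assumes E: "connected_graph V E" and A: "A \<subseteq> V" "A \<noteq> {}" "A \<noteq> V"
  shows "\<exists>u\<in>A. \<exists>v\<in>V - A. (u, v) \<in> E"
proof (rule ccontr)
  assume neg: "\<not> ?thesis"
  obtain u v where uv: "u \<in> A" "v \<in> V - A" using A by blast
  have "(u, v) \<in> E\<^sup>*" using E uv A by (auto simp: connected_graph_def)
  then have "v \<in> A"
  proof (induction rule: rtrancl_induct)
    case base
    then show ?case using uv by simp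
  next
    case (step y z)
    then show ?case using neg E by (auto simp: connected_graph_def)
  qed
  then show False using uv by simp
qed

definition coded_vectors :: "('f, 'z) local_state_scheme \<Rightarrow> 'f vec set" where
  "coded_vectors st = (case stage st of Coding t s W \<Rightarrow> W | _ \<Rightarrow> {})"

section \<open>One round of the protocol and the invariants of its stages\<close>

locale dissemination =
  fixes V :: "node set" and T :: "token set" and adv :: "'f::{field,finite} message adversary"
    and len d b :: nat
  assumes finite_V: "finite V" and V_nonempty: "V \<noteq> {}"
    and d_pos: "1 \<le> d" and d_le: "d \<le> b"
    and finite_T: "finite T" and length_T: "\<And>x. x \<in> T \<Longrightarrow> length x = d"
    and connected: "\<And>h. connected_graph V (adv h)"
    and len: "card V \<le> len"
begin

lemma b_pos: "1 \<le> b"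
  using d_pos d_le by simp

lemma len_pos: "0 < len"
  using len finite_V V_nonempty card_gt_0_iff by fastforce

abbreviation greedy_round where
  "greedy_round \<equiv> run_round (greedy_forward len d b) V adv"

definition next_state :: "'f message history \<Rightarrow> (node \<Rightarrow> 'f local_state) \<Rightarrow> (node \<Rightarrow> 'f message)
    \<Rightarrow> node \<Rightarrow> 'f local_state" where
  "next_state h \<sigma> msg v =
     greedy_receive len d b (\<sigma> v) (image_mset msg (mset_set {u. (u, v) \<in> adv h}))"

definition possible_messages :: "(node \<Rightarrow> 'f local_state) \<Rightarrow> (node \<Rightarrow> 'f message) \<Rightarrow> bool" where
  "possible_messages \<sigma> msg \<longleftrightarrow>
     (\<forall>v\<in>V. msg v \<in> set_pmf (stage_message d b (considered (\<sigma> v)) (stage (\<sigma> v))))"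

lemma greedy_round_eq:
  "greedy_round (h, \<sigma>) = map_pmf (\<lambda>msg. (h @ [(msg, adv h)], next_state h \<sigma> msg))
     (Pi_pmf V undefined (\<lambda>v. stage_message d b (considered (\<sigma> v)) (stage (\<sigma> v))))"
  by (simp add: run_round_def greedy_forward_def next_state_def[abs_def])

lemma greedy_round_support:
  assumes "y \<in> set_pmf (greedy_round (h, \<sigma>))"
  obtains msg where "possible_messages \<sigma> msg" "y = (h @ [(msg, adv h)], next_state h \<sigma> msg)"
  using assms finite_V
  by (auto simp: greedy_round_eq set_Pi_pmf PiE_dflt_def possible_messages_def)

text \<open>Growth needs only one crossing edge, so a single sender \<open>u\<close> decides: its
  message follows the marginal of the product distribution, and the other messages may be
  arbitrary.\<close>

lemma greedy_round_prob_ge: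
  assumes u: "u \<in> V"
    and Q: "\<And>msg. possible_messages \<sigma> msg \<Longrightarrow> msg u \<in> M \<Longrightarrow>
      (h @ [(msg, adv h)], next_state h \<sigma> msg) \<in> Q"
  shows "measure_pmf.prob (stage_message d b (considered (\<sigma> u)) (stage (\<sigma> u))) M
    \<le> measure_pmf.prob (greedy_round (h, \<sigma>)) Q"
proof -
  define p where "p = Pi_pmf V undefined (\<lambda>v. stage_message d b (considered (\<sigma> v)) (stage (\<sigma> v)))"
  have supp: "possible_messages \<sigma> msg" if "msg \<in> set_pmf p" for msg
    using that finite_V by (auto simp: p_def set_Pi_pmf PiE_dflt_def possible_messages_def)
  have "stage_message d b (considered (\<sigma> u)) (stage (\<sigma> u)) = map_pmf (\<lambda>f. f u) p"
    using u finite_V by (simp add: p_def Pi_pmf_component)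
  then have "measure_pmf.prob (stage_message d b (considered (\<sigma> u)) (stage (\<sigma> u))) M
      = measure_pmf.prob p {msg. msg u \<in> M}"
    by (simp add: vimage_def)
  also have "\<dots> \<le> measure_pmf.prob p {msg. (h @ [(msg, adv h)], next_state h \<sigma> msg) \<in> Q}"
    by (rule measure_pmf.finite_measure_mono_AE)
      (use supp Q in \<open>auto simp: AE_measure_pmf_iff\<close>)
  also have "\<dots> = measure_pmf.prob (greedy_round (h, \<sigma>)) Q"
    by (simp add: greedy_round_eq p_def vimage_def)
  finally show ?thesis .
qed

lemma edge_in_V: "(u, v) \<in> adv h \<Longrightarrow> u \<in> V \<and> v \<in> V"
  using connected[of h] by (auto simp: connected_graph_def)

lemma received_iff:
  "x \<in># image_mset msg (mset_set {u. (u, v) \<in> adv h}) \<longleftrightarrow> (\<exists>u. (u, v) \<in> adv h \<and> x = msg u)"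
proof -
  have "finite {u. (u, v) \<in> adv h}"
    by (rule finite_subset[OF _ finite_V]) (use edge_in_V in blast)
  then show ?thesis by auto
qed

text \<open>The union being exactly \<open>T\<close> says that no token is lost or invented. The
  inclusion of \<open>removed\<close> in \<open>known\<close> turns the end of the algorithm,
  \<open>removed = T\<close>, into complete knowledge.\<close>

definition base :: "(node \<Rightarrow> 'f local_state) \<Rightarrow> bool" where
  "base \<sigma> \<longleftrightarrow> (\<forall>v\<in>V. ident (\<sigma> v) = v \<and> removed (\<sigma> v) \<subseteq> known (\<sigma> v)) \<and> (\<Union>v\<in>V. known (\<sigma> v)) = T"

lemma considered_subset: "base \<sigma> \<Longrightarrow> v \<in> V \<Longrightarrow> considered (\<sigma> v) \<subseteq> T"
  by (auto simp: base_def considered_def)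

lemma finite_considered: "base \<sigma> \<Longrightarrow> v \<in> V \<Longrightarrow> finite (considered (\<sigma> v))"
  using considered_subset finite_T finite_subset by blast

definition same_knowledge :: "(node \<Rightarrow> 'f local_state) \<Rightarrow> (node \<Rightarrow> 'f local_state) \<Rightarrow> bool" where
  "same_knowledge \<sigma> \<sigma>' \<longleftrightarrow> (\<forall>v\<in>V. ident (\<sigma>' v) = ident (\<sigma> v) \<and> known (\<sigma>' v) = known (\<sigma> v) \<and>
     removed (\<sigma>' v) = removed (\<sigma> v))"

lemma same_knowledge_base: "same_knowledge \<sigma> \<sigma>' \<Longrightarrow> base \<sigma> \<Longrightarrow> base \<sigma>'"
  by (auto simp: same_knowledge_def base_def)

lemma same_knowledge_trans:
  "same_knowledge \<sigma> \<sigma>' \<Longrightarrow> same_knowledge \<sigma>' \<sigma>'' \<Longrightarrow> same_knowledge \<sigma> \<sigma>''"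
  by (auto simp: same_knowledge_def)

lemma same_knowledge_considered: "same_knowledge \<sigma> \<sigma>' \<Longrightarrow> v \<in> V \<Longrightarrow> considered (\<sigma>' v) = considered (\<sigma> v)"
  by (auto simp: same_knowledge_def considered_def)

definition forwarding :: "nat \<Rightarrow> (node \<Rightarrow> 'f local_state) \<Rightarrow> bool" where
  "forwarding t \<sigma> \<longleftrightarrow> base \<sigma> \<and> t < len \<and> (\<forall>v\<in>V. stage (\<sigma> v) = Forwarding t)"

definition candidates :: "(node \<Rightarrow> 'f local_state) \<Rightarrow> (nat \<times> node) set" where
  "candidates \<sigma> = (\<lambda>v. (card (considered (\<sigma> v)), v)) ` V"

text \<open>The lower bound counts the nodes already convinced, one more per round; with
  \<open>card V \<le> len\<close> it forces unanimity at the end of the stage without any appeal to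
  probability.\<close>

definition flooding :: "nat \<Rightarrow> (node \<Rightarrow> 'f local_state) \<Rightarrow> bool" where
  "flooding t \<sigma> \<longleftrightarrow> base \<sigma> \<and> t < len \<and>
     (\<exists>cand. (\<forall>v\<in>V. stage (\<sigma> v) = Flooding t (cand v) \<and> cand v \<in> candidates \<sigma>) \<and>
        min (card V) (Suc t) \<le> card {v \<in> V. cand v = best_candidate (candidates \<sigma>)})"

text \<open>The list \<open>xs\<close> is stored in no local state; it is the common reference
  against which the vectors of all nodes are judged. A holder of all source vectors makes every
  nonzero coefficient vector sensed somewhere, so that it can spread.\<close>

definition coding :: "token list \<Rightarrow> nat \<Rightarrow> (node \<Rightarrow> 'f local_state) \<Rightarrow> bool" where
  "coding xs t \<sigma> \<longleftrightarrow> base \<sigma> \<and> t < len \<and> xs \<noteq> [] \<and> distinct xs \<and> set xs \<subseteq> T \<and>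
     length xs \<le> b\<^sup>2 div d \<and>
     (\<forall>v\<in>V. stage (\<sigma> v) = Coding t (length xs) (coded_vectors (\<sigma> v)) \<and> finite (coded_vectors (\<sigma> v)) \<and>
        (\<forall>w \<in> coded_vectors (\<sigma> v). consistent b d xs w)) \<and>
     (\<exists>v\<in>V. source_vecs b d xs \<subseteq> coded_vectors (\<sigma> v))"

definition halted :: "(node \<Rightarrow> 'f local_state) \<Rightarrow> bool" where
  "halted \<sigma> \<longleftrightarrow> base \<sigma> \<and> (\<forall>v\<in>V. stage (\<sigma> v) = Halted)"

lemma finite_candidates: "finite (candidates \<sigma>)"
  using finite_V by (simp add: candidates_def)

lemma best_candidate_candidates:
  obtains l where "l \<in> V" "best_candidate (candidates \<sigma>) = (card (considered (\<sigma> l)), l)"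
    "\<And>v. v \<in> V \<Longrightarrow> card (considered (\<sigma> v)) \<le> card (considered (\<sigma> l))"
proof -
  have "candidates \<sigma> \<noteq> {}" using V_nonempty by (simp add: candidates_def)
  then have "best_candidate (candidates \<sigma>) \<in> candidates \<sigma>"
    by (intro best_candidate_mem finite_candidates)
  then obtain l where l: "l \<in> V" "best_candidate (candidates \<sigma>) = (card (considered (\<sigma> l)), l)"
    by (auto simp: candidates_def)
  then have "card (considered (\<sigma> l)) = Max (fst ` candidates \<sigma>)"
    using fst_best_candidate[of "candidates \<sigma>"] by simp
  moreover have "card (considered (\<sigma> v)) \<le> Max (fst ` candidates \<sigma>)" if "v \<in> V" for v
    using that finite_candidates by (intro Max_ge) (force simp: candidates_def)+
  ultimately show ?thesis using that l by simp
qed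

lemma forwarding_message:
  assumes "forwarding t \<sigma>" "possible_messages \<sigma> msg" "u \<in> V"
  obtains S where "msg u = Tokens S" "S \<subseteq> considered (\<sigma> u)" "card S \<le> b div d"
proof -
  let ?K = "considered (\<sigma> u)"
  have fin: "finite ?K" using assms by (simp add: forwarding_def finite_considered)
  \<comment> \<open>\<open>pmf_of_set\<close> has the intended support only for a nonempty finite
    set, so a subset of the prescribed size is exhibited.\<close>
  obtain S where "S \<subseteq> ?K" "card S = min (b div d) (card ?K)"
    using obtain_subset_with_card_n[OF min.cobounded2[of "b div d" "card ?K"]] by metis
  then have "{S. S \<subseteq> ?K \<and> card S = min (b div d) (card ?K)} \<noteq> {}" by blast
  moreover have "finite {S. S \<subseteq> ?K \<and> card S = min (b div d) (card ?K)}"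
    by (rule finite_subset[of _ "Pow ?K"]) (use fin in auto)
  ultimately have "set_pmf (stage_message d b ?K (stage (\<sigma> u))) =
      Tokens ` {S. S \<subseteq> ?K \<and> card S = min (b div d) (card ?K)}"
    using assms by (simp add: forwarding_def)
  then show ?thesis using assms(2,3) that by (force simp: possible_messages_def)
qed

lemma next_state_forwarding:
  assumes "forwarding t \<sigma>" "v \<in> V"
  shows "next_state h \<sigma> msg v =
    (let st' = (\<sigma> v)\<lparr>known := known (\<sigma> v) \<union> {x. \<exists>u S. (u, v) \<in> adv h \<and> msg u = Tokens S \<and> x \<in> S}\<rparr>
     in if Suc t < len then st'\<lparr>stage := Forwarding (Suc t)\<rparr>
        else st'\<lparr>stage := Flooding 0 (card (considered st'), v)\<rparr>)"
proof -
  have "\<Union>{S. Tokens S \<in># image_mset msg (mset_set {u. (u, v) \<in> adv h})}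
      = {x. \<exists>u S. (u, v) \<in> adv h \<and> msg u = Tokens S \<and> x \<in> S}"
    unfolding received_iff eq_commute[of "Tokens _"] by blast
  then show ?thesis
    using assms unfolding next_state_def greedy_receive_def forwarding_def base_def
    by (simp add: Let_def)
qed

lemma forwarding_step:
  assumes fw: "forwarding t \<sigma>" and msg: "possible_messages \<sigma> msg"
  shows "v \<in> V \<Longrightarrow> removed (next_state h \<sigma> msg v) = removed (\<sigma> v)"
    and "v \<in> V \<Longrightarrow> known (next_state h \<sigma> msg v) =
      known (\<sigma> v) \<union> {x. \<exists>u S. (u, v) \<in> adv h \<and> msg u = Tokens S \<and> x \<in> S}"
    and "Suc t < len \<Longrightarrow> forwarding (Suc t) (next_state h \<sigma> msg)"
    and "\<not> Suc t < len \<Longrightarrow> flooding 0 (next_state h \<sigma> msg)"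
proof -
  let ?\<sigma> = "next_state h \<sigma> msg"
  note nxt = next_state_forwarding[OF fw, of _ h msg]
  show R: "removed (?\<sigma> v) = removed (\<sigma> v)" if "v \<in> V" for v
    using nxt[OF that] by (simp add: Let_def)
  show K: "known (?\<sigma> v) = known (\<sigma> v) \<union> {x. \<exists>u S. (u, v) \<in> adv h \<and> msg u = Tokens S \<and> x \<in> S}"
    if "v \<in> V" for v
    using nxt[OF that] by (simp add: Let_def)
  have ident: "ident (?\<sigma> v) = v" if "v \<in> V" for v
    using nxt[OF that] fw that by (simp add: Let_def forwarding_def base_def)
  have base: "base \<sigma>" using fw by (simp add: forwarding_def)
  have "known (?\<sigma> v) \<subseteq> T" if v: "v \<in> V" for v
  proof
    fix x assume "x \<in> known (?\<sigma> v)"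
    then consider "x \<in> known (\<sigma> v)" | u S where "(u, v) \<in> adv h" "msg u = Tokens S" "x \<in> S"
      using K[OF v] by blast
    then show "x \<in> T"
    proof cases
      case 1
      then show ?thesis using base v by (auto simp: base_def)
    next
      case 2
      then have "u \<in> V" using edge_in_V by blast
      then show ?thesis
        using forwarding_message[OF fw msg, of u] considered_subset[OF base, of u] 2 by auto
    qed
  qed
  moreover have "known (\<sigma> v) \<subseteq> known (?\<sigma> v)" if "v \<in> V" for v
    using K[OF that] by blast
  ultimately have base': "base ?\<sigma>" using base R ident unfolding base_def by fast
  show "forwarding (Suc t) ?\<sigma>" if "Suc t < len"
    using base' that nxt by (simp add: forwarding_def Let_def)
  assume last: "\<not> Suc t < len"
  define cand where "cand v = (card (considered (?\<sigma> v)), v)" for v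
  have "stage (?\<sigma> v) = Flooding 0 (cand v)" if "v \<in> V" for v
    using last nxt[OF that] by (simp add: cand_def Let_def considered_def)
  moreover have "cand v \<in> candidates ?\<sigma>" if "v \<in> V" for v
    using that by (simp add: cand_def candidates_def)
  \<comment> \<open>The owner of the best candidate already holds it, which starts the count at
    one.\<close>
  moreover have "min (card V) (Suc 0) \<le> card {v \<in> V. cand v = best_candidate (candidates ?\<sigma>)}"
  proof -
    obtain l where "l \<in> V" "best_candidate (candidates ?\<sigma>) = cand l"
      using best_candidate_candidates[of ?\<sigma>] unfolding cand_def by metis
    then have "{v \<in> V. cand v = best_candidate (candidates ?\<sigma>)} \<noteq> {}" by auto
    then have "0 < card {v \<in> V. cand v = best_candidate (candidates ?\<sigma>)}"
      using finite_V by (simp add: card_gt_0_iff)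
    then show ?thesis by simp
  qed
  ultimately show "flooding 0 ?\<sigma>" using base' len_pos unfolding flooding_def by blast
qed

lemma flooding_step:
  assumes fl: "flooding t \<sigma>" and msg: "possible_messages \<sigma> msg"
  shows "same_knowledge \<sigma> (next_state h \<sigma> msg)"
    and "Suc t < len \<Longrightarrow> flooding (Suc t) (next_state h \<sigma> msg)"
    and "\<not> Suc t < len \<Longrightarrow> best_candidate (candidates \<sigma>) = (c, l) \<Longrightarrow> c = 0 \<Longrightarrow> halted (next_state h \<sigma> msg)"
    and "\<not> Suc t < len \<Longrightarrow> best_candidate (candidates \<sigma>) = (c, l) \<Longrightarrow> c \<noteq> 0 \<Longrightarrow>
      coding (take (min (b\<^sup>2 div d) c) (sorted_list_of_set (considered (\<sigma> l)))) 0 (next_state h \<sigma> msg)"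
proof -
  let ?\<sigma> = "next_state h \<sigma> msg"
  let ?best = "best_candidate (candidates \<sigma>)"
  obtain cand where stage: "\<And>v. v \<in> V \<Longrightarrow> stage (\<sigma> v) = Flooding t (cand v)"
    and cand: "\<And>v. v \<in> V \<Longrightarrow> cand v \<in> candidates \<sigma>"
    and many: "min (card V) (Suc t) \<le> card {v \<in> V. cand v = ?best}"
    using fl unfolding flooding_def by blast
  have base: "base \<sigma>" using fl by (simp add: flooding_def)
  have msg_u: "msg u = Candidate (fst (cand u)) (snd (cand u))" if "u \<in> V" for u
    using bspec[OF msg[unfolded possible_messages_def] that] stage[OF that] by simp
  define heard where "heard v = insert (cand v) {cand u |u. (u, v) \<in> adv h}" for v
  have heard: "insert (cand v) {(c, i). Candidate c i \<in># image_mset msg (mset_set {u. (u, v) \<in> adv h})}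
      = heard v" for v
    unfolding received_iff heard_def using msg_u edge_in_V[of _ v h]
    by (auto simp: prod_eq_iff)
  define cand' where "cand' v = best_candidate (heard v)" for v
  have nxt: "?\<sigma> v = (if Suc t < len then (\<sigma> v)\<lparr>stage := Flooding (Suc t) (cand' v)\<rparr>
      else after_flooding d b (cand' v) (\<sigma> v))" if "v \<in> V" for v
    unfolding next_state_def greedy_receive_def stage[OF that] stage.case Let_def heard cand'_def ..
  show same: "same_knowledge \<sigma> ?\<sigma>"
    using nxt by (simp add: same_knowledge_def after_flooding_def Let_def)
  have cands: "candidates ?\<sigma> = candidates \<sigma>"
    unfolding candidates_def using same_knowledge_considered[OF same] by (intro image_cong) auto
  have heard_sub: "heard v \<subseteq> candidates \<sigma>" if "v \<in> V" for v
    using cand that edge_in_V[of _ v h] by (auto simp: heard_def)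
  have cand'_mem: "cand' v \<in> candidates \<sigma>" if "v \<in> V" for v
  proof -
    have "best_candidate (heard v) \<in> heard v"
      by (rule best_candidate_mem)
        (use finite_subset[OF heard_sub[OF that] finite_candidates] in \<open>auto simp: heard_def\<close>)
    then show ?thesis using heard_sub[OF that] by (auto simp: cand'_def)
  qed
  let ?A = "{v \<in> V. cand v = ?best}"
  let ?A' = "{v \<in> V. cand' v = ?best}"
  have good: "cand' v = ?best" if "v \<in> V" "?best \<in> heard v" for v
    unfolding cand'_def using best_candidate_subset[OF finite_candidates heard_sub] that by blast
  have sub: "?A \<subseteq> ?A'" using good by (auto simp: heard_def)
  have A_ne: "?A \<noteq> {}"
  proof
    assume "?A = {}"
    then show False using many finite_V V_nonempty card_gt_0_iff[of V] by (simp add: \<open>?A = {}\<close>)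
  qed
  \<comment> \<open>Unless everyone is convinced, a boundary edge carries the best candidate to at
    least one more node.\<close>
  have many': "min (card V) (Suc (Suc t)) \<le> card ?A'"
  proof (cases "?A = V")
    case True
    then have "?A' = V" using sub by blast
    then show ?thesis by simp
  next
    case False
    obtain u v where uv: "u \<in> ?A" "v \<in> V - ?A" "(u, v) \<in> adv h"
      using connected_graph_boundary_edge[OF connected[of h] _ A_ne False] by blast
    then have "?best \<in> heard v" by (auto simp: heard_def intro: sym)
    then have "v \<in> ?A'" using good[of v] uv by blast
    then have "?A \<subset> ?A'" using sub uv by blast
    then have "card ?A < card ?A'" using finite_V by (intro psubset_card_mono) auto
    then show ?thesis using many by simp
  qed
  show "flooding (Suc t) ?\<sigma>" if "Suc t < len"
    unfolding flooding_def cands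
    using same_knowledge_base[OF same base] that nxt cand'_mem many'
    by (intro conjI exI[of _ cand']) auto
  assume last: "\<not> Suc t < len" and best: "?best = (c, l)"
  \<comment> \<open>In the last round \<open>Suc t\<close> has reached
    \<open>len \<ge> card V\<close>, so the minimum in \<open>many'\<close> is
    \<open>card V\<close>.\<close>
  have "card V \<le> card ?A'" using many' last len by simp
  then have "?A' = V" using finite_V by (intro card_seteq) auto
  then have all: "cand' v = (c, l)" if "v \<in> V" for v using that best by auto
  have nxt': "?\<sigma> v = after_flooding d b (c, l) (\<sigma> v)" if "v \<in> V" for v
    using nxt[OF that] last all[OF that] by simp
  have ident: "ident (\<sigma> v) = v" if "v \<in> V" for v using base that by (simp add: base_def)
  show "halted ?\<sigma>" if "c = 0"
    using same_knowledge_base[OF same base] that nxt' by (simp add: halted_def after_flooding_def)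
  assume c: "c \<noteq> 0"
  have l: "l \<in> V" "c = card (considered (\<sigma> l))"
    using best_candidate_candidates[of \<sigma>] best by auto
  let ?xs = "take (min (b\<^sup>2 div d) c) (sorted_list_of_set (considered (\<sigma> l)))"
  note fin = finite_considered[OF base l(1)]
  have length: "length ?xs = min (b\<^sup>2 div d) c" using l fin by simp
  \<comment> \<open>At least one token fits into a coding stage, so a leader with a positive count
    broadcasts a nonempty list.\<close>
  have "d \<le> b\<^sup>2" using d_le b_pos by (metis le_trans self_le_power zero_less_numeral)
  then have "b\<^sup>2 div d \<noteq> 0" using d_pos by (simp add: div_eq_0_iff)
  then have "?xs \<noteq> []" using c length by (metis list.size(3) min_def)
  moreover have "set ?xs \<subseteq> T" "distinct ?xs"
    using set_take_subset[of _ "sorted_list_of_set (considered (\<sigma> l))"] considered_subset[OF base l(1)] fin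
    by fastforce+
  moreover have st: "stage (?\<sigma> v) = Coding 0 (length ?xs) (if v = l then source_vecs b d ?xs else {})"
    if "v \<in> V" for v
    using nxt'[OF that] c ident[OF that] length by (simp add: after_flooding_def Let_def)
  moreover have "coded_vectors (?\<sigma> v) = (if v = l then source_vecs b d ?xs else {})"
    if "v \<in> V" for v
    using st[OF that] by (simp add: coded_vectors_def)
  ultimately show "coding ?xs 0 ?\<sigma>"
    unfolding coding_def
    using same_knowledge_base[OF same base] len_pos l length finite_source_vecs source_vecs_consistent
    by auto
qed

lemma coding_message:
  assumes "coding xs t \<sigma>" "possible_messages \<sigma> msg" "u \<in> V"
  obtains w where "msg u = Coded w" "consistent b d xs w"
proof -
  let ?W = "coded_vectors (\<sigma> u)"
  obtain w where w: "msg u = Coded w" "w \<in> set_pmf (random_combination (coded_dim b d (length xs)) ?W)"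
    using assms by (auto simp: coding_def possible_messages_def)
  then obtain c where c: "w = vec (coded_dim b d (length xs)) (\<lambda>j. \<Sum>u\<in>?W. c u * u $ j)"
    using random_combination_support by blast
  have cons: "consistent b d xs u" if "u \<in> ?W" for u
    using assms(1,3) that unfolding coding_def by blast
  have "consistent b d xs w"
    by (rule consistent_combination[where W = ?W and c = c, OF cons]) (simp_all add: c)
  then show ?thesis using that w by blast
qed

lemma coding_step:
  assumes co: "coding xs t \<sigma>" and msg: "possible_messages \<sigma> msg"
  shows "Suc t < len \<Longrightarrow> coding xs (Suc t) (next_state h \<sigma> msg)"
    and "Suc t < len \<Longrightarrow> same_knowledge \<sigma> (next_state h \<sigma> msg)"
    and "Suc t < len \<Longrightarrow> v \<in> V \<Longrightarrow> coded_vectors (next_state h \<sigma> msg v) =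
      coded_vectors (\<sigma> v) \<union> {w. \<exists>u. (u, v) \<in> adv h \<and> msg u = Coded w}"
    and "\<not> Suc t < len \<Longrightarrow> forwarding 0 (next_state h \<sigma> msg)"
    and "\<not> Suc t < len \<Longrightarrow> v \<in> V \<Longrightarrow>
      (\<And>\<mu> i. i < num_blocks b d (length xs) \<Longrightarrow> \<mu> i \<noteq> 0 \<Longrightarrow>
        senses (num_blocks b d (length xs)) \<mu> (coded_vectors (\<sigma> v))) \<Longrightarrow>
      known (next_state h \<sigma> msg v) = known (\<sigma> v) \<union> set xs \<and>
      removed (next_state h \<sigma> msg v) = removed (\<sigma> v) \<union> set xs"
proof -
  let ?\<sigma> = "next_state h \<sigma> msg"
  define W' where "W' v = coded_vectors (\<sigma> v) \<union> {w. \<exists>u. (u, v) \<in> adv h \<and> msg u = Coded w}" for v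
  define D where "D v = decode b d (length xs) (W' v)" for v
  have base: "base \<sigma>" using co by (simp add: coding_def)
  have stage: "stage (\<sigma> v) = Coding t (length xs) (coded_vectors (\<sigma> v))" if "v \<in> V" for v
    using co that by (simp add: coding_def)
  have nxt: "?\<sigma> v = (if Suc t < len then (\<sigma> v)\<lparr>stage := Coding (Suc t) (length xs) (W' v)\<rparr>
      else (\<sigma> v)\<lparr>known := known (\<sigma> v) \<union> D v, removed := removed (\<sigma> v) \<union> D v, stage := Forwarding 0\<rparr>)"
    if "v \<in> V" for v
  proof -
    have "{w. Coded w \<in># image_mset msg (mset_set {u. (u, v) \<in> adv h})}
        = {w. \<exists>u. (u, v) \<in> adv h \<and> msg u = Coded w}"
      unfolding received_iff by metis
    then show ?thesis
      unfolding next_state_def greedy_receive_def by (simp add: stage[OF that] W'_def D_def Let_def)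
  qed
  have W': "finite (W' v)" "w \<in> W' v \<Longrightarrow> consistent b d xs w" if "v \<in> V" for v w
  proof -
    have "{w. \<exists>u. (u, v) \<in> adv h \<and> msg u = Coded w} \<subseteq> (\<lambda>u. case msg u of Coded w \<Rightarrow> w | _ \<Rightarrow> undefined) ` V"
      using edge_in_V by force
    then have "finite {w. \<exists>u. (u, v) \<in> adv h \<and> msg u = Coded w}"
      using finite_V finite_subset by blast
    then show "finite (W' v)" using co that by (auto simp: W'_def coding_def)
    assume w: "w \<in> W' v"
    show "consistent b d xs w"
    proof (cases "w \<in> coded_vectors (\<sigma> v)")
      case True
      then show ?thesis using co that by (auto simp: coding_def)
    next
      case False
      then obtain u where u: "(u, v) \<in> adv h" "msg u = Coded w" using w by (auto simp: W'_def)
      then show ?thesis using coding_message[OF co msg, of u] edge_in_V by auto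
    qed
  qed
  show same: "same_knowledge \<sigma> ?\<sigma>" if "Suc t < len"
    using nxt that by (simp add: same_knowledge_def)
  show cv: "coded_vectors (?\<sigma> v) = coded_vectors (\<sigma> v) \<union> {w. \<exists>u. (u, v) \<in> adv h \<and> msg u = Coded w}"
    if "Suc t < len" "v \<in> V" for v
    using nxt[OF that(2)] that(1) by (simp add: coded_vectors_def W'_def)
  show "coding xs (Suc t) ?\<sigma>" if t: "Suc t < len"
  proof -
    have "coded_vectors (?\<sigma> v) = W' v" if "v \<in> V" for v
      using cv[OF t that] by (simp add: W'_def)
    moreover have "\<exists>v\<in>V. source_vecs b d xs \<subseteq> W' v"
      using co by (auto simp: coding_def W'_def)
    moreover have "stage (?\<sigma> v) = Coding (Suc t) (length xs) (W' v)" if "v \<in> V" for v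
      using nxt[OF that] t by simp
    ultimately show ?thesis
      using same_knowledge_base[OF same[OF t] base] t co W' unfolding coding_def by simp
  qed
  assume last: "\<not> Suc t < len"
  have xs: "set xs \<subseteq> T" "\<And>x. x \<in> set xs \<Longrightarrow> length x = d"
    using co length_T by (auto simp: coding_def)
  \<comment> \<open>A node that cannot decode gets \<open>{}\<close>, so the invariant on known
    tokens survives a failed coding stage.\<close>
  have D: "D v \<in> {{}, set xs}" if "v \<in> V" for v
    unfolding D_def using decode_consistent(1)[OF d_pos d_le xs(2) W'[OF that]] by blast
  have kn: "known (?\<sigma> v) = known (\<sigma> v) \<union> D v" "removed (?\<sigma> v) = removed (\<sigma> v) \<union> D v"
    "ident (?\<sigma> v) = ident (\<sigma> v)" "stage (?\<sigma> v) = Forwarding 0" if "v \<in> V" for v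
    using nxt[OF that] last by simp_all
  have "(\<Union>v\<in>V. known (?\<sigma> v)) = T"
  proof -
    have "(\<Union>v\<in>V. known (?\<sigma> v)) = (\<Union>v\<in>V. known (\<sigma> v)) \<union> (\<Union>v\<in>V. D v)" using kn(1) by auto
    moreover have "(\<Union>v\<in>V. D v) \<subseteq> T" using D xs(1) by blast
    ultimately show ?thesis using base by (auto simp: base_def)
  qed
  then have "base ?\<sigma>" using base kn unfolding base_def by fastforce
  then show "forwarding 0 ?\<sigma>" using kn len_pos by (simp add: forwarding_def)
  assume v: "v \<in> V" and sens: "\<And>\<mu> i. i < num_blocks b d (length xs) \<Longrightarrow> \<mu> i \<noteq> 0 \<Longrightarrow>
        senses (num_blocks b d (length xs)) \<mu> (coded_vectors (\<sigma> v))"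
  \<comment> \<open>The vectors of the last round enter the decoding too, but sensing is assumed
    from before it, and more vectors cannot destroy it.\<close>
  have sens': "senses (num_blocks b d (length xs)) \<mu> (W' v)" if "i < num_blocks b d (length xs)" "\<mu> i \<noteq> 0" for \<mu> i
    using sens[of i \<mu>, OF that] unfolding senses_def W'_def by blast
  have "D v = set xs"
    unfolding D_def by (rule decode_consistent(2)[OF d_pos d_le xs(2) W'[OF v]]) (auto intro: sens')
  then show "known (?\<sigma> v) = known (\<sigma> v) \<union> set xs \<and> removed (?\<sigma> v) = removed (\<sigma> v) \<union> set xs"
    using kn[OF v] by simp
qed

lemma halted_step:
  assumes "halted \<sigma>"
  shows "halted (next_state h \<sigma> msg)" and "v \<in> V \<Longrightarrow> next_state h \<sigma> msg v = \<sigma> v"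
proof -
  show *: "next_state h \<sigma> msg v = \<sigma> v" if "v \<in> V" for v
    using assms that by (simp add: halted_def next_state_def greedy_receive_def)
  then show "halted (next_state h \<sigma> msg)" using assms by (simp add: halted_def base_def)
qed

end


section \<open>Success probability of one iteration\<close>

text \<open>Removing \<open>x\<close> matches the sets that contain it with the subsets of
  \<open>K - {x}\<close> of one element less; the absorption identity for binomial coefficients then
  gives the ratio.\<close>

lemma random_subset_member_prob:
  assumes K: "finite K" "x \<in> K" and g: "1 \<le> g"
  shows "measure_pmf.prob (pmf_of_set {S. S \<subseteq> K \<and> card S = min g (card K)}) {S. x \<in> S}
    = real (min g (card K)) / card K"
proof -
  let ?c = "min g (card K)"
  let ?\<S> = "{S. S \<subseteq> K \<and> card S = ?c}"
  have Kpos: "0 < card K" using K card_gt_0_iff by blast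
  then have c: "1 \<le> ?c" using g by simp
  have fin: "finite ?\<S>" by (rule finite_subset[of _ "Pow K"]) (use K in auto)
  have card_S: "card ?\<S> = card K choose ?c" using K n_subsets by blast
  have pos: "0 < card ?\<S>" unfolding card_S by simp
  have "?\<S> \<inter> {S. x \<in> S} = insert x ` {S. S \<subseteq> K - {x} \<and> card S = ?c - 1}"
  proof (intro equalityI subsetI)
    fix S assume "S \<in> ?\<S> \<inter> {S. x \<in> S}"
    then have "S = insert x (S - {x})" "S - {x} \<subseteq> K - {x}" "card (S - {x}) = ?c - 1" by auto
    then show "S \<in> insert x ` {S. S \<subseteq> K - {x} \<and> card S = ?c - 1}" by blast
  next
    fix S assume "S \<in> insert x ` {S. S \<subseteq> K - {x} \<and> card S = ?c - 1}"
    then obtain S' where S': "S = insert x S'" "S' \<subseteq> K - {x}" "card S' = ?c - 1" by blast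
    then have "finite S'" "x \<notin> S'" using K finite_subset by blast+
    then have "card S = ?c" using S' c by simp
    then show "S \<in> ?\<S> \<inter> {S. x \<in> S}" using S' K by blast
  qed
  moreover have "inj_on (insert x) {S. S \<subseteq> K - {x} \<and> card S = ?c - 1}"
    by (rule inj_onI) blast
  ultimately have "card (?\<S> \<inter> {S. x \<in> S}) = card {S. S \<subseteq> K - {x} \<and> card S = ?c - 1}"
    by (simp add: card_image)
  also have "\<dots> = (card K - 1) choose (?c - 1)"
    using n_subsets[of "K - {x}" "?c - 1"] K by simp
  finally have card_Sx: "card (?\<S> \<inter> {S. x \<in> S}) = (card K - 1) choose (?c - 1)" .
  have "?c * (card K choose ?c) = card K * ((card K - 1) choose (?c - 1))"
    using c by (intro times_binomial_minus1_eq) simp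
  then have "?c * card ?\<S> = card K * card (?\<S> \<inter> {S. x \<in> S})" by (simp only: card_S card_Sx)
  then have eq: "real ?c * card ?\<S> = real (card K) * card (?\<S> \<inter> {S. x \<in> S})"
    unfolding of_nat_mult[symmetric] by (rule arg_cong)
  have frac: "a / s = c' / k" if "c' * s = k * a" "0 < s" "0 < k" for a s c' k :: real
    using that by (simp add: field_simps)
  have "real (card (?\<S> \<inter> {S. x \<in> S})) / card ?\<S> = real ?c / card K"
    by (rule frac) (fact eq, simp_all only: of_nat_0_less_iff pos Kpos)
  moreover have "?\<S> \<noteq> {}" using pos by (metis card.empty less_irrefl)
  ultimately show ?thesis using fin by (simp add: measure_pmf_of_set)
qed

context dissemination
begin

definition iteration_start :: "token set \<Rightarrow> 'f message history \<times> (node \<Rightarrow> 'f local_state) \<Rightarrow> bool" where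
  "iteration_start R y \<longleftrightarrow> forwarding 0 (snd y) \<and> (\<forall>v\<in>V. removed (snd y v) = R)"

lemma iteration_start_subset: "iteration_start R y \<Longrightarrow> R \<subseteq> T"
  using V_nonempty by (fastforce simp: iteration_start_def forwarding_def base_def)

abbreviation group_size :: nat where
  "group_size \<equiv> b div d"

lemma group_size_pos: "1 \<le> group_size"
  using d_pos d_le by (simp add: div_greater_zero_iff Suc_leI)

text \<open>Bounding \<open>p\<close> by 1 and through a product treats two cases at once: if all
  considered tokens fit into one message, the chance is 1, and otherwise it is
  \<open>group_size\<close> over their number.\<close>

lemma forwarding_token_prob:
  fixes p :: real
  assumes fw: "forwarding t \<sigma>" and u: "u \<in> V" "x \<in> considered (\<sigma> u)"
    and p: "p \<le> 1" "p * card (considered (\<sigma> u)) \<le> group_size"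
    and Q: "\<And>msg S. possible_messages \<sigma> msg \<Longrightarrow> msg u = Tokens S \<Longrightarrow> x \<in> S \<Longrightarrow>
      (h @ [(msg, adv h)], next_state h \<sigma> msg) \<in> Q"
  shows "p \<le> measure_pmf.prob (greedy_round (h, \<sigma>)) Q"
proof -
  let ?K = "considered (\<sigma> u)"
  have fin: "finite ?K" using fw u by (simp add: forwarding_def finite_considered)
  then have pos: "0 < card ?K" using u card_gt_0_iff by blast
  have "p * card ?K \<le> real (min group_size (card ?K))"
    using p mult_right_mono[of p 1 "real (card ?K)"] by (simp add: of_nat_min)
  then have "p \<le> real (min group_size (card ?K)) / card ?K"
    using pos by (simp add: pos_le_divide_eq)
  also have "\<dots> = measure_pmf.prob (pmf_of_set {S. S \<subseteq> ?K \<and> card S = min group_size (card ?K)}) {S. x \<in> S}"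
    using random_subset_member_prob[OF fin u(2) group_size_pos] by simp
  also have "\<dots> = measure_pmf.prob (stage_message d b ?K (stage (\<sigma> u))) {m. \<exists>S. m = Tokens S \<and> x \<in> S}"
    using fw u by (simp add: forwarding_def vimage_def)
  also have "\<dots> \<le> measure_pmf.prob (greedy_round (h, \<sigma>)) Q"
    by (rule greedy_round_prob_ge[OF u(1)]) (use Q in blast)
  finally show ?thesis .
qed

text \<open>The last round of the stage already switches to flooding, so the invariant has to change
  shape at \<open>t = len\<close>.\<close>

definition forwarded :: "token set \<Rightarrow> nat \<Rightarrow> 'f message history \<times> (node \<Rightarrow> 'f local_state) \<Rightarrow> bool" where
  "forwarded R t y \<longleftrightarrow> (\<forall>v\<in>V. removed (snd y v) = R) \<and>
     (if t < len then forwarding t (snd y) else flooding 0 (snd y))"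

lemma forwarded_step:
  assumes "t < len" "forwarded R t y" "z \<in> set_pmf (greedy_round y)"
  shows "forwarded R (Suc t) z" and "v \<in> V \<Longrightarrow> known (snd y v) \<subseteq> known (snd z v)"
proof -
  obtain h \<sigma> where y: "y = (h, \<sigma>)" by (cases y)
  obtain msg where msg: "possible_messages \<sigma> msg" "z = (h @ [(msg, adv h)], next_state h \<sigma> msg)"
    using assms(3) unfolding y by (rule greedy_round_support)
  have fw: "forwarding t \<sigma>" using assms(1,2) by (simp add: forwarded_def y)
  note st = forwarding_step[OF fw msg(1), where h = h]
  show "forwarded R (Suc t) z"
    using assms(2) st(1,3,4) by (simp add: forwarded_def y msg(2))
  show "v \<in> V \<Longrightarrow> known (snd y v) \<subseteq> known (snd z v)"
    using st(2) by (auto simp: y msg(2))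
qed

lemma forwarded_base: "forwarded R t y \<Longrightarrow> base (snd y)"
  by (auto simp: forwarded_def forwarding_def flooding_def split: if_splits)

lemma forwarding_phase:
  assumes "iteration_start R s" "y \<in> set_pmf (kernel_power greedy_round len s)"
  shows "forwarded R len y"
proof (rule kernel_power_invariant[where Inv = "forwarded R", OF _ _ assms(2)])
  show "forwarded R 0 s" using assms(1) len_pos by (simp add: iteration_start_def forwarded_def)
qed (rule forwarded_step(1))

text \<open>The event that all nodes know fewer than \<open>M\<close> tokens plays the part of
  \<open>E\<close> in the tail bound: it guarantees the growth rate \<open>p\<close>, and as
  knowledge only grows, holding now means having held in all earlier rounds.\<close>

lemma token_spread_prob:
  fixes M p :: real
  assumes start: "iteration_start R s" and x: "x \<in> T - R" and M: "0 < M"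
    and p: "p = min 1 (group_size / M)"
  shows "measure_pmf.prob (kernel_power greedy_round len s)
      {y. (\<forall>v\<in>V. real (card (known (snd y v) - R)) < M) \<and>
          real (card {v \<in> V. x \<in> known (snd y v)}) < card V * p}
    \<le> exp (card V * p - p * len / 2)"
proof (rule epidemic_tail_bound[where Inv = "forwarded R" and V = V])
  have p01: "0 \<le> p" "p \<le> 1" using M p by auto
  then show "0 \<le> p" "p \<le> 1" by auto
  show "card V * p \<le> card V" using p01 by (simp add: mult_left_le)
  show "finite V" using finite_V .
  show "{v \<in> V. x \<in> known (snd y v)} \<subseteq> V" for y :: "'f message history \<times> (node \<Rightarrow> 'f local_state)"
    by blast
  show "forwarded R 0 s" using start len_pos by (simp add: iteration_start_def forwarded_def)
  fix t :: nat and y assume t: "t < len" and y: "forwarded R t y"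
  show "forwarded R (Suc t) z" if "z \<in> set_pmf (greedy_round y)" for z
    using forwarded_step[OF t y that] by blast
  have mono: "known (snd y v) \<subseteq> known (snd z v)" if "z \<in> set_pmf (greedy_round y)" "v \<in> V" for z v
    using forwarded_step[OF t y that(1)] that(2) by blast
  then show "{v \<in> V. x \<in> known (snd y v)} \<subseteq> {v \<in> V. x \<in> known (snd z v)}"
    if "z \<in> set_pmf (greedy_round y)" for z using that by blast
  show "\<forall>v\<in>V. real (card (known (snd y v) - R)) < M"
    if z: "z \<in> set_pmf (greedy_round y)" "\<forall>v\<in>V. real (card (known (snd z v) - R)) < M" for z
  proof
    fix v assume v: "v \<in> V"
    have "known (snd z v) \<subseteq> T"
      using forwarded_base[of R "Suc t" z] forwarded_step[OF t y z(1)] v by (auto simp: base_def)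
    then have "card (known (snd y v) - R) \<le> card (known (snd z v) - R)"
      using mono[OF z(1) v] finite_T by (intro card_mono) (auto intro: finite_subset)
    then show "real (card (known (snd y v) - R)) < M" using z(2) v by fastforce
  qed
  assume few: "\<forall>v\<in>V. real (card (known (snd y v) - R)) < M"
    and not_all: "{v \<in> V. x \<in> known (snd y v)} \<noteq> V"
  obtain h \<sigma> where y': "y = (h, \<sigma>)" by (cases y)
  have fw: "forwarding t \<sigma>" using y t by (simp add: forwarded_def y')
  let ?I = "{v \<in> V. x \<in> known (\<sigma> v)}"
  have "?I \<noteq> {}" using fw x by (auto simp: forwarding_def base_def)
  then obtain u v where uv: "u \<in> ?I" "v \<in> V - ?I" "(u, v) \<in> adv h"
    using connected_graph_boundary_edge[OF connected[of h], of ?I] not_all by (auto simp: y')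
  have cons: "considered (\<sigma> u) = known (\<sigma> u) - R"
    using y uv by (simp add: considered_def forwarded_def y')
  show "p \<le> measure_pmf.prob (greedy_round y) {z. {v \<in> V. x \<in> known (snd z v)} \<noteq> {v \<in> V. x \<in> known (snd y v)}}"
    unfolding y'
  proof (rule forwarding_token_prob[OF fw])
    show "u \<in> V" "x \<in> considered (\<sigma> u)" using uv x cons by auto
    have "p * card (considered (\<sigma> u)) \<le> p * M"
      using few uv cons p01 by (intro mult_left_mono) (auto simp: y' less_imp_le)
    also have "\<dots> \<le> group_size / M * M" using M p by (intro mult_right_mono) auto
    finally show "p * card (considered (\<sigma> u)) \<le> group_size" using M by simp
    fix msg S assume msg: "possible_messages \<sigma> msg" "msg u = Tokens S" "x \<in> S"
    have "x \<in> known (next_state h \<sigma> msg v)"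
      using forwarding_step(2)[OF fw msg(1), of v h] uv msg by blast
    then show "(h @ [(msg, adv h)], next_state h \<sigma> msg) \<in>
        {z. {v \<in> V. x \<in> known (snd z v)} \<noteq> {v \<in> V. x \<in> known (snd (h, \<sigma>) v)}}"
      using uv by auto
  qed (use p01 in simp)
qed

text \<open>
  If every token reached a \<open>p\<close>-fraction of the nodes then, counting pairs of a node and a token, some
  node knows at least \<open>k p \<ge> M\<close> of the \<open>k\<close> tokens.
\<close>

lemma forwarding_phase_prob:
  fixes M :: real
  assumes start: "iteration_start R s" and k: "k = card (T - R)" "0 < k" "k \<le> card V"
    and M: "M = min (real k) (sqrt (real (group_size * k)))"
    and large: "50 * card V \<le> len"
  shows "measure_pmf.prob (kernel_power greedy_round len s)
      (- {y. forwarded R len y \<and> (\<exists>v\<in>V. M \<le> card (considered (snd y v)))})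
    \<le> k * exp (- 24 * sqrt (card V))"
proof -
  let ?p = "kernel_power greedy_round len s"
  define p where "p = min 1 (group_size / M)"
  let ?n = "real (card V)"
  have n: "1 \<le> ?n" using finite_V V_nonempty by (simp add: Suc_leI card_gt_0_iff)
  have g: "1 \<le> real group_size" using group_size_pos by linarith
  have "0 < sqrt (real (group_size * k))" using g k group_size_pos by simp
  then have Mpos: "0 < M" using M k by simp
  have Mk: "M \<le> k" "M \<le> sqrt (real (group_size * k))" using M by auto
  have M2: "M * M \<le> group_size * k"
  proof -
    have "M * M \<le> sqrt (real (group_size * k)) * sqrt (real (group_size * k))"
      using Mk Mpos by (intro mult_mono) auto
    then show ?thesis by simp
  qed
  \<comment> \<open>This inequality dictates the choice of \<open>M\<close>: up to the cap
    \<open>k\<close>, it is the largest value with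
    \<open>M \<le> k * (group_size / M)\<close>.\<close>
  have kp: "M \<le> k * p"
  proof -
    have "M \<le> k * (group_size / M)" using M2 Mpos by (simp add: pos_le_divide_eq mult.commute)
    then show ?thesis using Mk by (simp add: p_def min_def)
  qed
  \<comment> \<open>From \<open>sqrt group_size \<le> group_size\<close> and
    \<open>k \<le> card V\<close>; it keeps the tail exponent of order \<open>sqrt ?n\<close> even
    when \<open>p\<close> is small.\<close>
  have np: "sqrt ?n \<le> ?n * p"
  proof -
    have "M \<le> group_size * sqrt k"
    proof -
      have "sqrt (real (group_size * k)) = sqrt group_size * sqrt k" by (simp add: real_sqrt_mult)
      also have "\<dots> \<le> group_size * sqrt k"
        using g real_sqrt_le_mono[of group_size "real group_size * group_size"]
        by (intro mult_right_mono) (auto simp: mult_le_cancel_left1)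
      finally show ?thesis using Mk by simp
    qed
    also have "\<dots> \<le> group_size * sqrt ?n" using k g by (intro mult_left_mono) auto
    finally have "M * sqrt ?n \<le> group_size * sqrt ?n * sqrt ?n"
      by (rule mult_right_mono) simp
    also have "\<dots> = group_size * ?n" by (simp add: mult.assoc)
    finally have "M * sqrt ?n \<le> group_size * ?n" .
    then have "sqrt ?n \<le> ?n * (group_size / M)"
      using Mpos n by (simp add: pos_le_divide_eq mult.commute)
    moreover have "sqrt ?n \<le> ?n"
      using n real_sqrt_le_mono[of ?n "?n * ?n"] by (simp add: mult_le_cancel_left1)
    ultimately show ?thesis by (simp add: p_def min_def)
  qed
  have p0: "0 \<le> p" using Mpos by (simp add: p_def)
  define B :: "token \<Rightarrow> ('f message history \<times> (node \<Rightarrow> 'f local_state)) set" where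
    "B x = {y. (\<forall>v\<in>V. real (card (known (snd y v) - R)) < M) \<and>
      real (card {v \<in> V. x \<in> known (snd y v)}) < ?n * p}" for x
  let ?A = "- {y. forwarded R len y \<and> (\<exists>v\<in>V. M \<le> card (considered (snd y v)))}"
  have "?A \<inter> set_pmf ?p \<subseteq> (\<Union>x\<in>T - R. B x)"
  proof
    fix y assume y: "y \<in> ?A \<inter> set_pmf ?p"
    have fw: "forwarded R len y" using forwarding_phase[OF start] y by blast
    have cons: "considered (snd y v) = known (snd y v) - R" if "v \<in> V" for v
      using fw that by (simp add: considered_def forwarded_def)
    have few: "\<forall>v\<in>V. real (card (known (snd y v) - R)) < M"
      using y fw cons by (auto simp: not_le)
    have kn: "known (snd y v) - R = {x \<in> T - R. x \<in> known (snd y v)}" if "v \<in> V" for v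
      using forwarded_base[OF fw] that by (auto simp: base_def)
    show "y \<in> (\<Union>x\<in>T - R. B x)"
    proof (rule ccontr)
      assume "y \<notin> (\<Union>x\<in>T - R. B x)"
      then have many: "?n * p \<le> real (card {v \<in> V. x \<in> known (snd y v)})" if "x \<in> T - R" for x
        using few that by (force simp: B_def not_less)
      have "?n * M \<le> k * (?n * p)" using mult_left_mono[OF kp, of ?n] n by (simp add: mult.left_commute)
      also have "\<dots> = (\<Sum>x\<in>T - R. ?n * p)" using k by simp
      also have "\<dots> \<le> (\<Sum>x\<in>T - R. real (card {v \<in> V. x \<in> known (snd y v)}))"
        using many by (intro sum_mono) auto
      also have "\<dots> = real (\<Sum>x\<in>T - R. card {v \<in> V. x \<in> known (snd y v)})" by simp
      also have "(\<Sum>x\<in>T - R. card {v \<in> V. x \<in> known (snd y v)}) =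
          (\<Sum>v\<in>V. card {x \<in> T - R. x \<in> known (snd y v)})"
        using finite_V finite_T by (intro sum_multicount_gen) auto
      also have "real \<dots> = (\<Sum>v\<in>V. real (card (known (snd y v) - R)))" using kn by simp
      also have "\<dots> < (\<Sum>v\<in>V. M)" using few finite_V V_nonempty by (intro sum_strict_mono) auto
      also have "\<dots> = ?n * M" by simp
      finally show False by simp
    qed
  qed
  then have "measure_pmf.prob ?p (?A \<inter> set_pmf ?p) \<le> measure_pmf.prob ?p (\<Union>x\<in>T - R. B x)"
    by (intro measure_pmf.finite_measure_mono) auto
  also have "\<dots> \<le> (\<Sum>x\<in>T - R. measure_pmf.prob ?p (B x))"
    using finite_T by (intro measure_pmf.finite_measure_subadditive_finite) auto
  also have "\<dots> \<le> (\<Sum>x\<in>T - R. exp (- 24 * sqrt ?n))"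
  proof (rule sum_mono)
    fix x assume x: "x \<in> T - R"
    have "measure_pmf.prob ?p (B x) \<le> exp (?n * p - p * len / 2)"
      unfolding B_def by (rule token_spread_prob[OF start x Mpos p_def])
    \<comment> \<open>With \<open>len \<ge> 50 * card V\<close> the exponent is at most
      \<open>?n * p - 25 * ?n * p\<close>, hence at most \<open>- 24 * sqrt ?n\<close> by
      \<open>np\<close>.\<close>
    also have "?n * p - p * len / 2 \<le> - 24 * sqrt ?n"
    proof -
      have "50 * ?n \<le> real len" using large by linarith
      then have "p * (50 * ?n) \<le> p * len" using p0 by (rule mult_left_mono)
      then show ?thesis using np by (simp add: mult.commute)
    qed
    finally show "measure_pmf.prob ?p (B x) \<le> exp (- 24 * sqrt ?n)" by simp
  qed
  also have "\<dots> = k * exp (- 24 * sqrt ?n)" using k by simp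
  finally show ?thesis by (simp add: measure_Int_set_pmf)
qed

section \<open>Flooding and coding stages\<close>

lemma flooding_phase:
  assumes fl: "flooding 0 (snd s)" and best: "best_candidate (candidates (snd s)) = (c, l)"
    and y: "y \<in> set_pmf (kernel_power greedy_round len s)"
  shows "same_knowledge (snd s) (snd y)"
    and "c = 0 \<Longrightarrow> halted (snd y)"
    and "c \<noteq> 0 \<Longrightarrow>
      coding (take (min (b\<^sup>2 div d) c) (sorted_list_of_set (considered (snd s l)))) 0 (snd y)"
proof -
  let ?xs = "take (min (b\<^sup>2 div d) c) (sorted_list_of_set (considered (snd s l)))"
  define Inv where "Inv t y \<longleftrightarrow> same_knowledge (snd s) (snd y) \<and>
    (if t < len then flooding t (snd y) else if c = 0 then halted (snd y) else coding ?xs 0 (snd y))"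
    for t :: nat and y :: "'f message history \<times> (node \<Rightarrow> 'f local_state)"
  have "Inv len y"
  proof (rule kernel_power_invariant[OF _ _ y])
    show "Inv 0 s" using fl len_pos by (simp add: Inv_def same_knowledge_def)
    fix t z w assume t: "t < len" and z: "Inv t z" and w: "w \<in> set_pmf (greedy_round z)"
    obtain h \<sigma> where z': "z = (h, \<sigma>)" by (cases z)
    obtain msg where msg: "possible_messages \<sigma> msg" "w = (h @ [(msg, adv h)], next_state h \<sigma> msg)"
      using w unfolding z' by (rule greedy_round_support)
    have fl': "flooding t \<sigma>" and same: "same_knowledge (snd s) \<sigma>"
      using z t by (auto simp: Inv_def z')
    \<comment> \<open>Flooding changes no knowledge, so the leader is fixed by the state at the
      start of the stage.\<close>
    have cons: "considered (\<sigma> v) = considered (snd s v)" if "v \<in> V" for v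
      using same_knowledge_considered[OF same that] .
    then have "candidates \<sigma> = candidates (snd s)"
      unfolding candidates_def by (intro image_cong) auto
    then have best': "best_candidate (candidates \<sigma>) = (c, l)" using best by simp
    then have "l \<in> V" using best_candidate_candidates[of \<sigma>] by auto
    then have l: "considered (\<sigma> l) = considered (snd s l)" by (rule cons)
    note st = flooding_step[OF fl' msg(1), where h = h]
    show "Inv (Suc t) w"
      using same_knowledge_trans[OF same st(1)] st(2) st(3)[OF _ best'] st(4)[OF _ best']
      by (simp add: Inv_def msg(2) l)
  qed
  then show "same_knowledge (snd s) (snd y)" "c = 0 \<Longrightarrow> halted (snd y)"
    "c \<noteq> 0 \<Longrightarrow> coding ?xs 0 (snd y)" by (auto simp: Inv_def)
qed

definition informed :: "nat \<Rightarrow> (nat \<Rightarrow> 'f) \<Rightarrow> 'f message history \<times> (node \<Rightarrow> 'f local_state) \<Rightarrow> node set" where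
  "informed m \<mu> y = {v \<in> V. senses m \<mu> (coded_vectors (snd y v))}"

lemma coding_step_round:
  assumes "coding xs t (snd y)" "Suc t < len" "z \<in> set_pmf (greedy_round y)"
  shows "coding xs (Suc t) (snd z)" "same_knowledge (snd y) (snd z)" "informed m \<mu> y \<subseteq> informed m \<mu> z"
proof -
  obtain h \<sigma> where y: "y = (h, \<sigma>)" by (cases y)
  obtain msg where msg: "possible_messages \<sigma> msg" "z = (h @ [(msg, adv h)], next_state h \<sigma> msg)"
    using assms(3) unfolding y by (rule greedy_round_support)
  have co: "coding xs t \<sigma>" using assms(1) by (simp add: y)
  note st = coding_step[OF co msg(1), where h = h]
  show "coding xs (Suc t) (snd z)" "same_knowledge (snd y) (snd z)"
    using st(1,2) assms(2) by (simp_all add: y msg(2))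
  show "informed m \<mu> y \<subseteq> informed m \<mu> z"
    using st(3)[OF assms(2)] by (auto simp: informed_def senses_def y msg(2))
qed

text \<open>Here \<open>E\<close> is trivially true and the target is all of \<open>V\<close>. The
  count stops at \<open>len - 1\<close> because the final round leaves the coding stage, where
  \<open>coded_vectors\<close> becomes empty.\<close>

lemma coefficient_spread_prob:
  assumes co: "coding xs 0 (snd s)" and m: "m = num_blocks b d (length xs)"
    and i: "i < m" "\<mu> i \<noteq> 0"
  shows "measure_pmf.prob (kernel_power greedy_round (len - 1) s)
      {y. card (informed m \<mu> y) < card V}
    \<le> exp (real (card V) - (1/2) * real (len - 1) / 2)"
proof -
  have "measure_pmf.prob (kernel_power greedy_round (len - 1) s)
      {y. True \<and> real (card (informed m \<mu> y)) < real (card V)}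
    \<le> exp (real (card V) - (1/2) * real (len - 1) / 2)"
  proof (rule epidemic_tail_bound[where V = V and Inv = "\<lambda>t y. coding xs t (snd y)"])
    show "coding xs 0 (snd s)" by fact
    fix t :: nat and y :: "'f message history \<times> (node \<Rightarrow> 'f local_state)"
    assume t: "t < len - 1" and y: "coding xs t (snd y)"
    then have t': "Suc t < len" by simp
    show "coding xs (Suc t) (snd z)" "informed m \<mu> y \<subseteq> informed m \<mu> z"
      if "z \<in> set_pmf (greedy_round y)" for z
      using coding_step_round[OF y t' that] by auto
    assume not_all: "informed m \<mu> y \<noteq> V"
    obtain h \<sigma> where y': "y = (h, \<sigma>)" by (cases y)
    have co': "coding xs t \<sigma>" using y by (simp add: y')
    have "informed m \<mu> y \<noteq> {}"
    proof -
      obtain v where v: "v \<in> V" "source_vecs b d xs \<subseteq> coded_vectors (\<sigma> v)"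
        using co' by (auto simp: coding_def)
      then have "senses m \<mu> (coded_vectors (\<sigma> v))"
        using source_vecs_senses[of i b d xs \<mu>] i m by (auto simp: senses_def)
      then show ?thesis using v by (auto simp: informed_def y')
    qed
    then obtain u v where uv: "u \<in> informed m \<mu> y" "v \<in> V - informed m \<mu> y" "(u, v) \<in> adv h"
      using connected_graph_boundary_edge[OF connected[of h], of "informed m \<mu> y"] not_all
      by (auto simp: informed_def)
    have u: "u \<in> V" "senses m \<mu> (coded_vectors (\<sigma> u))" using uv by (auto simp: informed_def y')
    have "1/2 \<le> measure_pmf.prob (random_combination (coded_dim b d (length xs)) (coded_vectors (\<sigma> u)))
        {w. (\<Sum>i<m. \<mu> i * w $ i) \<noteq> 0}"
      using co' u m by (intro random_combination_senses) (auto simp: coding_def coded_dim_def)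
    also have "\<dots> = measure_pmf.prob (stage_message d b (considered (\<sigma> u)) (stage (\<sigma> u)))
        {x. \<exists>w. x = Coded w \<and> (\<Sum>i<m. \<mu> i * w $ i) \<noteq> 0}"
    proof -
      have "stage (\<sigma> u) = Coding t (length xs) (coded_vectors (\<sigma> u))"
        using co' u by (simp add: coding_def)
      then have "stage_message d b (considered (\<sigma> u)) (stage (\<sigma> u)) =
          map_pmf Coded (random_combination (coded_dim b d (length xs)) (coded_vectors (\<sigma> u)))"
        by (metis stage_message.simps(3))
      then show ?thesis by (simp add: vimage_def)
    qed
    also have "\<dots> \<le> measure_pmf.prob (greedy_round (h, \<sigma>)) {z. informed m \<mu> z \<noteq> informed m \<mu> y}"
    proof (rule greedy_round_prob_ge[OF u(1)])
      fix msg assume msg: "possible_messages \<sigma> msg"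
        "msg u \<in> {x. \<exists>w. x = Coded w \<and> (\<Sum>i<m. \<mu> i * w $ i) \<noteq> 0}"
      then obtain w where w: "msg u = Coded w" "(\<Sum>i<m. \<mu> i * w $ i) \<noteq> 0" by blast
      have "w \<in> coded_vectors (next_state h \<sigma> msg v)"
        using coding_step(3)[OF co' msg(1) t', of v h] uv w by blast
      then have "v \<in> informed m \<mu> (h @ [(msg, adv h)], next_state h \<sigma> msg)"
        using uv w by (auto simp: informed_def senses_def)
      then show "(h @ [(msg, adv h)], next_state h \<sigma> msg) \<in> {z. informed m \<mu> z \<noteq> informed m \<mu> y}"
        using uv by blast
    qed
    finally show "1/2 \<le> measure_pmf.prob (greedy_round y) {z. informed m \<mu> z \<noteq> informed m \<mu> y}"
      by (simp add: y')
  qed (auto simp: informed_def finite_V)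
  then show ?thesis by simp
qed

lemma coding_phase_prob:
  assumes co: "coding xs 0 (snd s)" and R: "\<And>v. v \<in> V \<Longrightarrow> removed (snd s v) = R"
    and T: "card T \<le> card V" and large: "(4 * CARD('f) + 53) * card V \<le> len"
  shows "measure_pmf.prob (kernel_power greedy_round len s) (- {y. iteration_start (R \<union> set xs) y})
    \<le> exp (- 12 * real (card V))"
proof -
  define m where "m = num_blocks b d (length xs)"
  let ?n = "card V"
  let ?q = "CARD('f)"
  let ?p = "kernel_power greedy_round (len - 1) s"
  \<comment> \<open>Extensional functions make the coefficient vectors a finite set of at most
    \<open>CARD('f) ^ m\<close> elements, as the union bound requires.\<close>
  define Z where "Z = {\<mu> \<in> {..<m} \<rightarrow>\<^sub>E (UNIV :: 'f set). \<exists>i<m. \<mu> i \<noteq> 0}"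
  define G where "G = {y. coding xs (len - 1) (snd y) \<and> same_knowledge (snd s) (snd y) \<and>
    (\<forall>\<mu>\<in>Z. informed m \<mu> y = V)}"
  define B where "B \<mu> = {y. card (informed m \<mu> y) < ?n}" for \<mu>
  have n: "1 \<le> ?n" using finite_V V_nonempty by (simp add: Suc_leI card_gt_0_iff)
  have finZ: "finite Z" by (rule finite_subset[of _ "{..<m} \<rightarrow>\<^sub>E UNIV"]) (auto simp: Z_def finite_PiE)
  have supp: "coding xs (len - 1) (snd y) \<and> same_knowledge (snd s) (snd y)" if "y \<in> set_pmf ?p" for y
  proof (rule kernel_power_invariant[where Inv = "\<lambda>t y. coding xs t (snd y) \<and> same_knowledge (snd s) (snd y)", OF _ _ that])
    show "coding xs 0 (snd s) \<and> same_knowledge (snd s) (snd s)"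
      using co by (simp add: same_knowledge_def)
    fix t z w assume t: "t < len - 1" and z: "coding xs t (snd z) \<and> same_knowledge (snd s) (snd z)"
      and w: "w \<in> set_pmf (greedy_round z)"
    have "Suc t < len" using t by simp
    then show "coding xs (Suc t) (snd w) \<and> same_knowledge (snd s) (snd w)"
      using coding_step_round(1,2)[OF conjunct1[OF z] _ w] same_knowledge_trans[OF conjunct2[OF z]] by blast
  qed
  have "- G \<inter> set_pmf ?p \<subseteq> (\<Union>\<mu>\<in>Z. B \<mu>)"
  proof
    fix y assume y: "y \<in> - G \<inter> set_pmf ?p"
    then obtain \<mu> where \<mu>: "\<mu> \<in> Z" "informed m \<mu> y \<noteq> V"
      using supp[of y] unfolding G_def by blast
    then have "informed m \<mu> y \<subset> V" by (auto simp: informed_def)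
    then have "card (informed m \<mu> y) < ?n" using finite_V by (rule psubset_card_mono[rotated])
    then show "y \<in> (\<Union>\<mu>\<in>Z. B \<mu>)" using \<mu> by (auto simp: B_def)
  qed
  then have "measure_pmf.prob ?p (- G \<inter> set_pmf ?p) \<le> measure_pmf.prob ?p (\<Union>\<mu>\<in>Z. B \<mu>)"
    by (intro measure_pmf.finite_measure_mono) auto
  also have "\<dots> \<le> (\<Sum>\<mu>\<in>Z. measure_pmf.prob ?p (B \<mu>))"
    using finZ by (intro measure_pmf.finite_measure_subadditive_finite) auto
  also have "\<dots> \<le> (\<Sum>\<mu>\<in>Z. exp (real ?n - (1/2) * real (len - 1) / 2))"
  proof (rule sum_mono)
    fix \<mu> assume "\<mu> \<in> Z"
    then obtain i where "i < m" "\<mu> i \<noteq> 0" by (auto simp: Z_def)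
    then show "measure_pmf.prob ?p (B \<mu>) \<le> exp (real ?n - (1/2) * real (len - 1) / 2)"
      unfolding B_def by (rule coefficient_spread_prob[OF co m_def])
  qed
  also have "\<dots> = card Z * exp (real ?n - (1/2) * real (len - 1) / 2)" by simp
  also have "\<dots> \<le> exp (real ?q * ?n) * exp (real ?n - (1/2) * real (len - 1) / 2)"
  proof (rule mult_right_mono)
    have "card Z \<le> card ({..<m} \<rightarrow>\<^sub>E (UNIV :: 'f set))"
      by (intro card_mono) (auto simp: Z_def finite_PiE)
    then have "real (card Z) \<le> real ?q ^ m" by (simp add: card_PiE)
    also have "\<dots> \<le> real ?q ^ ?n"
    proof (rule power_increasing)
      have "m \<le> length xs" unfolding m_def using num_blocks_bounds(2)[OF d_pos d_le] .
      also have "length xs \<le> card T"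
        using co finite_T by (metis coding_def distinct_card card_mono)
      finally show "m \<le> ?n" using T by simp
    qed (simp add: Suc_leI)
    \<comment> \<open>The crude bound \<open>q \<le> exp q\<close> makes the stage length linear
      instead of logarithmic in the field size, which is a constant.\<close>
    also have "\<dots> \<le> exp (real ?q) ^ ?n"
    proof (rule power_mono)
      show "real ?q \<le> exp (real ?q)" using exp_ge_add_one_self[of "real ?q"] by linarith
    qed simp
    also have "\<dots> = exp (real ?q * ?n)" by (simp add: exp_of_nat2_mult)
    finally show "real (card Z) \<le> exp (real ?q * ?n)" .
  qed simp
  also have "\<dots> = exp (real ?q * ?n + (real ?n - (1/2) * real (len - 1) / 2))" by (simp add: exp_add)
  also have "\<dots> \<le> exp (- 12 * real ?n)"
  proof -
    \<comment> \<open>The constant 53: one \<open>?n\<close> covers the round lost in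
      \<open>len - 1\<close>, and a quarter of the remaining \<open>(4 * ?q + 52) * ?n\<close>
      exceeds \<open>?q * ?n + ?n\<close> by \<open>12 * ?n\<close>.\<close>
    have "(4 * ?q + 52) * ?n \<le> len - 1" using large n by (simp add: algebra_simps)
    then have "real ((4 * ?q + 52) * ?n) \<le> real (len - 1)" by (rule of_nat_mono)
    then show ?thesis by (simp add: algebra_simps)
  qed
  finally have bound: "measure_pmf.prob ?p (- G) \<le> exp (- 12 * real ?n)" by (simp add: measure_Int_set_pmf)
  have last: "iteration_start (R \<union> set xs) z" if y: "y \<in> G" and z: "z \<in> set_pmf (greedy_round y)" for y z
  proof -
    obtain h \<sigma> where y': "y = (h, \<sigma>)" by (cases y)
    obtain msg where msg: "possible_messages \<sigma> msg" "z = (h @ [(msg, adv h)], next_state h \<sigma> msg)"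
      using z unfolding y' by (rule greedy_round_support)
    have co': "coding xs (len - 1) \<sigma>" and same: "same_knowledge (snd s) \<sigma>"
      using y by (auto simp: G_def y')
    have l: "\<not> Suc (len - 1) < len" by simp
    have "removed (next_state h \<sigma> msg v) = R \<union> set xs" if v: "v \<in> V" for v
    proof -
      have "senses m \<mu> (coded_vectors (\<sigma> v))" if \<mu>: "i < m" "\<mu> i \<noteq> 0" for \<mu> i
      proof -
        \<comment> \<open>Sensing reads only the entries below \<open>m\<close>, so
          \<open>\<mu>\<close> may be replaced by its restriction.\<close>
        have "restrict \<mu> {..<m} \<in> Z" using \<mu> by (auto simp: Z_def)
        then have "v \<in> informed m (restrict \<mu> {..<m}) y" using y v by (auto simp: G_def)
        then show ?thesis by (simp add: informed_def senses_def y')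
      qed
      then have "removed (next_state h \<sigma> msg v) = removed (\<sigma> v) \<union> set xs"
        using coding_step(5)[OF co' msg(1) l v] unfolding m_def by blast
      then show ?thesis using same R v by (simp add: same_knowledge_def)
    qed
    then show ?thesis using coding_step(4)[OF co' msg(1) l] by (simp add: iteration_start_def msg(2))
  qed
  have "measure_pmf.prob (?p \<bind> greedy_round) (- {y. iteration_start (R \<union> set xs) y}) \<le> exp (- 12 * real ?n) + 0"
  proof (rule prob_bind_le[OF bound])
    fix y assume y: "y \<in> G"
    have "measure_pmf.prob (greedy_round y) (- {y. iteration_start (R \<union> set xs) y}) = 0"
      by (rule prob_eq_0I) (use last[OF y] in blast)
    then show "measure_pmf.prob (greedy_round y) (- {y. iteration_start (R \<union> set xs) y}) \<le> 0"
      by simp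
  qed simp
  moreover have "?p \<bind> greedy_round = kernel_power greedy_round len s"
    using len_pos by (cases len) auto
  ultimately show ?thesis by simp
qed

end


section \<open>Counting iterations\<close>

text \<open>
  With \<open>x\<close> tokens fitting into one coding stage and \<open>g\<close> into one message, an iteration at \<open>k\<close> tokens
  removes \<open>min x (min k (sqrt (g * k)))\<close> of them.  Above \<open>k = x\<^sup>2 / g\<close> the first summand
  pays for the iteration, below it the second one does.
\<close>

definition iteration_potential :: "real \<Rightarrow> real \<Rightarrow> real \<Rightarrow> real" where
  "iteration_potential x g k = k / x + 2 * sqrt (min k (x\<^sup>2 / g) / g)"

lemma iteration_potential_nonneg:
  assumes "0 < x" "0 < g" "0 \<le> k"
  shows "0 \<le> iteration_potential x g k"
  using assms by (simp add: iteration_potential_def)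

text \<open>In the square-root regime \<open>k\<close> drops by \<open>sqrt (g * k)\<close>, so
  \<open>sqrt (k / g)\<close> drops by at least 1/2, whence the factor 2 in the potential. The
  iteration that leaves no tokens is exempt and is paid for separately.\<close>

lemma iteration_potential_decreases:
  assumes x: "0 < x" and g: "0 < g" and k: "0 < k" and k': "0 < k'"
    and step: "k' + min x (min k (sqrt (g * k))) \<le> k"
  shows "iteration_potential x g k' \<le> iteration_potential x g k - 1"
proof -
  have pos: "0 < sqrt (g * k)" using g k by simp
  have "0 < min x (min k (sqrt (g * k)))" using x k pos by (simp only: min_less_iff_conj)
  then have le: "k' \<le> k" using step by linarith
  consider "x \<le> k" "x \<le> sqrt (g * k)" | "k \<le> x" "k \<le> sqrt (g * k)"
    | "sqrt (g * k) \<le> k" "sqrt (g * k) \<le> x"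
    by linarith
  then show ?thesis
  proof cases
    case 1
    then have "k' \<le> k - x" using step by (simp add: min_absorb1)
    then have "k' / x \<le> (k - x) / x" using x by (intro divide_right_mono) auto
    also have "\<dots> = k / x - 1" using x by (simp add: diff_divide_distrib)
    finally have "k' / x \<le> k / x - 1" .
    moreover have "sqrt (min k' (x\<^sup>2 / g) / g) \<le> sqrt (min k (x\<^sup>2 / g) / g)"
      using le g by (intro real_sqrt_le_mono divide_right_mono min.mono) auto
    ultimately show ?thesis unfolding iteration_potential_def by linarith
  next
    case 2
    \<comment> \<open>An iteration removing all \<open>k\<close> tokens contradicts
      \<open>0 < k'\<close>.\<close>
    then have "k' + k \<le> k" using step by (simp add: min_absorb1 min_absorb2)
    then show ?thesis using k' by simp
  next
    case 3
    then have k'_le: "k' \<le> k - sqrt (g * k)" using step by (simp add: min_absorb2)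
    \<comment> \<open>Thus the minimum in the potential is \<open>k\<close> itself, and likewise
      \<open>k'\<close> after the iteration.\<close>
    have "g * k \<le> x\<^sup>2" using 3(2) g k by (metis real_le_rsqrt real_sqrt_le_iff real_sqrt_unique sqrt_le_D)
    then have kx: "k \<le> x\<^sup>2 / g" using g by (simp add: pos_le_divide_eq mult.commute)
    define y where "y = sqrt (k / g)"
    have y: "y\<^sup>2 = k / g" "0 \<le> y" using g k by (auto simp: y_def)
    have "sqrt (g * k) = g * y"
    proof -
      have "g * k = g\<^sup>2 * (k / g)" using g by (simp add: power2_eq_square)
      then have "sqrt (g * k) = sqrt (g\<^sup>2) * y" by (simp only: y_def real_sqrt_mult)
      then show ?thesis using g by simp
    qed
    then have k'g: "k' / g \<le> y\<^sup>2 - y"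
      using k'_le g divide_right_mono[OF k'_le, of g] by (simp add: y diff_divide_distrib)
    have "0 < k' / g" using k' g by simp
    then have "y * 1 < y * y" using k'g by (simp add: power2_eq_square)
    then have "1 < y" using y(2) mult_less_cancel_left_pos[of y 1 y] by (cases "y = 0") auto
    \<comment> \<open>Completing the square, \<open>y\<^sup>2 - y \<le> (y - 1/2)\<^sup>2\<close>;
      the bound \<open>1 < y\<close> then gives the root without an absolute value.\<close>
    have "sqrt (k' / g) \<le> sqrt ((y - 1/2)\<^sup>2)"
      using k'g by (intro real_sqrt_le_mono) (simp add: power2_eq_square algebra_simps)
    then have "sqrt (k' / g) \<le> y - 1/2" using \<open>1 < y\<close> by simp
    moreover have "k' / x \<le> k / x" using le x by (simp add: divide_right_mono)
    ultimately show ?thesis using kx le by (simp add: iteration_potential_def y_def min_def)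
  qed
qed

text \<open>Rounding down in the two divisions costs a factor of 2 each. The capped root is at most
  \<open>x / g\<close>, and the quotient of \<open>b\<^sup>2 / d\<close> by \<open>b / d\<close> is
  \<open>b\<close>, the origin of the additive term.\<close>

lemma iteration_potential_le:
  fixes b d k :: nat
  assumes d: "1 \<le> d" "d \<le> b"
  shows "iteration_potential (real (b\<^sup>2 div d)) (real (b div d)) (real k)
    \<le> 2 * (real k * real d / (real b)\<^sup>2) + 4 * real b"
proof -
  define x where "x = real (b\<^sup>2 div d)"
  define g where "g = real (b div d)"
  have half: "real m \<le> 2 * real d * real (m div d)" if "d \<le> m" for m
  proof -
    have "1 \<le> m div d" using that d by (simp add: div_greater_zero_iff Suc_leI)
    then have "d \<le> m div d * d" by simp
    moreover have "m = m div d * d + m mod d" by simp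
    moreover have "m mod d < d" using d by simp
    ultimately have "m \<le> 2 * (m div d * d)" by linarith
    then have "real m \<le> real (2 * (m div d * d))" by (rule of_nat_mono)
    then show ?thesis by (simp add: mult_ac)
  qed
  have bpos: "0 < real b" "0 < real d" using d by auto
  have "d \<le> b\<^sup>2" using d by (metis le_trans self_le_power zero_less_numeral)
  then have x_ge: "(real b)\<^sup>2 \<le> 2 * real d * x" using half[of "b\<^sup>2"] by (simp add: x_def)
  have g_ge: "real b \<le> 2 * real d * g" using half[OF d(2)] by (simp add: g_def)
  have "real (b\<^sup>2 div d * d) \<le> real (b\<^sup>2)" by (intro of_nat_mono) simp
  then have x_le: "x * d \<le> (real b)\<^sup>2" by (simp add: x_def)
  have xpos: "0 < x"
  proof (rule ccontr)
    assume "\<not> 0 < x"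
    then have "x = 0" by (simp add: x_def)
    then show False using x_ge bpos by simp
  qed
  have gpos: "0 < g"
  proof (rule ccontr)
    assume "\<not> 0 < g"
    then have "g = 0" by (simp add: g_def)
    then show False using g_ge bpos by simp
  qed
  have "real k * (real b)\<^sup>2 \<le> real k * (2 * real d * x)" using x_ge by (rule mult_left_mono) simp
  then have "k / x \<le> 2 * (real k * real d / (real b)\<^sup>2)"
    using xpos bpos by (simp add: field_simps)
  moreover have "sqrt (min (real k) (x\<^sup>2 / g) / g) \<le> 2 * real b"
  proof -
    have "sqrt (min (real k) (x\<^sup>2 / g) / g) \<le> sqrt (x\<^sup>2 / g / g)"
      using gpos by (intro real_sqrt_le_mono divide_right_mono) auto
    also have "x\<^sup>2 / g / g = (x / g)\<^sup>2" by (simp add: power2_eq_square)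
    also have "sqrt ((x / g)\<^sup>2) = x / g" using xpos gpos by simp
    also have "x / g \<le> 2 * real b"
    proof -
      have "x * d * 1 \<le> real b * (2 * real d * g)"
        using x_le mult_left_mono[OF g_ge, of "real b"] by (simp add: power2_eq_square)
      then have "d * x \<le> d * (2 * real b * g)" by (simp add: mult_ac)
      then show ?thesis using bpos gpos by (simp add: pos_divide_le_eq)
    qed
    finally show ?thesis .
  qed
  ultimately show ?thesis unfolding iteration_potential_def x_def[symmetric] g_def[symmetric] by simp
qed

context dissemination
begin

definition finished :: "'f message history \<times> (node \<Rightarrow> 'f local_state) \<Rightarrow> bool" where
  "finished y \<longleftrightarrow> halted (snd y) \<and> (\<forall>v\<in>V. known (snd y v) = T)"

lemma finished_stays:
  assumes "finished s" "y \<in> set_pmf (kernel_power greedy_round t s)"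
  shows "finished y"
proof (rule kernel_power_invariant[where Inv = "\<lambda>_. finished", OF _ assms])
  fix z w assume z: "finished z" and w: "w \<in> set_pmf (greedy_round z)"
  obtain h \<sigma> where z': "z = (h, \<sigma>)" by (cases z)
  obtain msg where msg: "w = (h @ [(msg, adv h)], next_state h \<sigma> msg)"
    using w unfolding z' by (rule greedy_round_support)
  have "halted \<sigma>" using z by (simp add: finished_def z')
  then show "finished w" using halted_step[where \<sigma> = \<sigma> and h = h and msg = msg] z by (simp add: finished_def z' msg)
qed

text \<open>One more forwarding and flooding stage, hence \<open>2 * len\<close> rounds, lets all
  nodes find out that the largest count is zero. This happens with certainty.\<close>

lemma no_tokens_left_finishes:
  assumes start: "iteration_start T s" and t: "2 * len \<le> t"
    and y: "y \<in> set_pmf (kernel_power greedy_round t s)"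
  shows "finished y"
proof -
  have "t = (len + len) + (t - 2 * len)" using t by simp
  then obtain z w where z: "z \<in> set_pmf (kernel_power greedy_round len s)"
    and w: "w \<in> set_pmf (kernel_power greedy_round len z)"
    and y': "y \<in> set_pmf (kernel_power greedy_round (t - 2 * len) w)"
    using y by (metis (no_types, lifting) kernel_power_add set_bind_pmf UN_E)
  have fw: "forwarded T len z" by (rule forwarding_phase[OF start z])
  then have fl: "flooding 0 (snd z)" and rem: "\<And>v. v \<in> V \<Longrightarrow> removed (snd z v) = T"
    by (simp_all add: forwarded_def)
  have kn: "known (snd z v) = T" if "v \<in> V" for v
    using fl rem[OF that] that by (auto simp: flooding_def base_def)
  obtain l where l: "l \<in> V" "best_candidate (candidates (snd z)) = (card (considered (snd z l)), l)"
    using best_candidate_candidates by blast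
  have "considered (snd z l) = {}" using l kn rem by (simp add: considered_def)
  then have "best_candidate (candidates (snd z)) = (0, l)" using l(2) by simp
  then have "halted (snd w)" "same_knowledge (snd z) (snd w)"
    using flooding_phase[OF fl _ w] by auto
  then have "finished w" using kn by (simp add: finished_def same_knowledge_def)
  then show ?thesis using y' by (rule finished_stays)
qed

text \<open>The sets \<open>removed\<close> agree again only if every node decodes, which is what
  \<open>iteration_start\<close> records at the end. The error is that of forwarding plus that of
  coding; flooding adds none.\<close>

lemma iteration_prob:
  assumes start: "iteration_start R s" and k: "k = card (T - R)" "0 < k"
    and T: "card T \<le> card V" and large: "(4 * CARD('f) + 53) * card V \<le> len"
  shows "measure_pmf.prob (kernel_power greedy_round (len + (len + len)) s)
      (- {y. \<exists>R'. iteration_start R' y \<and>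
          real (card (T - R')) + min (real (b\<^sup>2 div d)) (min (real k) (sqrt (real group_size * real k))) \<le> real k})
    \<le> card V * exp (- 24 * sqrt (card V)) + exp (- 12 * real (card V))"
proof -
  define M where "M = min (real k) (sqrt (real (group_size * k)))"
  let ?A = "- {y. \<exists>R'. iteration_start R' y \<and> real (card (T - R')) + min (real (b\<^sup>2 div d)) M \<le> real k}"
  define G where "G = {y. forwarded R len y \<and> (\<exists>v\<in>V. M \<le> card (considered (snd y v)))}"
  let ?e = "exp (- 12 * real (card V))"
  have kV: "k \<le> card V" using k T card_mono[OF finite_T, of "T - R"] by simp
  have "50 * card V \<le> (4 * CARD('f) + 53) * card V" by (rule mult_right_mono) simp_all
  then have "50 * card V \<le> len" using large by (rule le_trans)
  then have "measure_pmf.prob (kernel_power greedy_round len s) (- G) \<le> k * exp (- 24 * sqrt (card V))"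
    unfolding G_def using forwarding_phase_prob[OF start k kV M_def] by blast
  also have "\<dots> \<le> card V * exp (- 24 * sqrt (card V))" using kV by (intro mult_right_mono) auto
  finally have e1: "measure_pmf.prob (kernel_power greedy_round len s) (- G) \<le> card V * exp (- 24 * sqrt (card V))" .
  have rest: "measure_pmf.prob (kernel_power greedy_round (len + len) y) ?A \<le> ?e" if y: "y \<in> G" for y
  proof -
    have fl: "flooding 0 (snd y)" and rem: "\<And>v. v \<in> V \<Longrightarrow> removed (snd y v) = R"
      using y by (simp_all add: G_def forwarded_def)
    have base: "base (snd y)" using fl by (simp add: flooding_def)
    obtain l where l: "l \<in> V" "best_candidate (candidates (snd y)) = (card (considered (snd y l)), l)"
      "\<And>v. v \<in> V \<Longrightarrow> card (considered (snd y v)) \<le> card (considered (snd y l))"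
      using best_candidate_candidates[of "snd y"] by blast
    define c where "c = card (considered (snd y l))"
    define xs where "xs = take (min (b\<^sup>2 div d) c) (sorted_list_of_set (considered (snd y l)))"
    have "M \<le> real c"
    proof -
      obtain v where "v \<in> V" "M \<le> card (considered (snd y v))" using y by (auto simp: G_def)
      then show ?thesis using l(3)[of v] by (simp add: c_def)
    qed
    have "0 < sqrt (real (group_size * k))" using k group_size_pos by simp
    then have "0 < M" using k by (simp add: M_def)
    then have c: "c \<noteq> 0" using \<open>M \<le> real c\<close> by auto
    have fin: "finite (considered (snd y l))" using finite_considered[OF base l(1)] .
    have len_xs: "length xs = min (b\<^sup>2 div d) c" using fin by (simp add: xs_def c_def)
    have "set xs \<subseteq> considered (snd y l)"
      using set_take_subset[of _ "sorted_list_of_set (considered (snd y l))"] fin by (simp add: xs_def)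
    then have xs: "set xs \<subseteq> T - R"
      using considered_subset[OF base l(1)] rem[OF l(1)] by (auto simp: considered_def)
    have "distinct xs" by (simp add: xs_def)
    then have card_xs: "card (set xs) = min (b\<^sup>2 div d) c" using len_xs by (simp add: distinct_card)
    have "T - (R \<union> set xs) = (T - R) - set xs" by blast
    then have "card (T - (R \<union> set xs)) = k - card (set xs)"
      using xs k by (simp add: card_Diff_subset)
    moreover have "card (set xs) \<le> k" using xs k finite_T by (simp add: card_mono)
    ultimately have "real (card (T - (R \<union> set xs))) + real (min (b\<^sup>2 div d) c) = real k"
      using card_xs by simp
    moreover have "min (real (b\<^sup>2 div d)) M \<le> real (min (b\<^sup>2 div d) c)"
      using \<open>M \<le> real c\<close> by (auto simp: min_def)
    ultimately have small: "real (card (T - (R \<union> set xs))) + min (real (b\<^sup>2 div d)) M \<le> real k" by linarith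
    have co: "coding xs 0 (snd z)" and same: "same_knowledge (snd y) (snd z)"
      if z: "z \<in> set_pmf (kernel_power greedy_round len y)" for z
      using flooding_phase[OF fl l(2) z] c by (simp_all add: c_def[symmetric] xs_def)
    have "measure_pmf.prob (kernel_power greedy_round len y \<bind> kernel_power greedy_round len) ?A \<le> 0 + ?e"
    proof (rule prob_bind_le[where G = UNIV])
      fix z assume z: "z \<in> set_pmf (kernel_power greedy_round len y)"
      have "removed (snd z v) = R" if "v \<in> V" for v
        using same[OF z] rem that by (simp add: same_knowledge_def)
      then have "measure_pmf.prob (kernel_power greedy_round len z) (- {y. iteration_start (R \<union> set xs) y}) \<le> ?e"
        by (rule coding_phase_prob[OF co[OF z] _ T large])
      moreover have "measure_pmf.prob (kernel_power greedy_round len z) ?A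
          \<le> measure_pmf.prob (kernel_power greedy_round len z) (- {y. iteration_start (R \<union> set xs) y})"
        using small by (intro measure_pmf.finite_measure_mono) auto
      ultimately show "measure_pmf.prob (kernel_power greedy_round len z) ?A \<le> ?e" by linarith
    qed simp_all
    then show ?thesis by (simp add: kernel_power_add)
  qed
  have "measure_pmf.prob (kernel_power greedy_round len s \<bind> kernel_power greedy_round (len + len)) ?A
      \<le> card V * exp (- 24 * sqrt (card V)) + ?e"
    by (rule prob_bind_le[OF e1]) (use rest in auto)
  then show ?thesis by (simp only: kernel_power_add[symmetric] M_def of_nat_mult)
qed

text \<open>Two clocks: the potential bounds the number of iterations and so the time, while the
  error is charged per token, every good iteration removing at least one. The extra one in
  \<open>j + 1\<close> pays for the iteration that takes the last tokens, the final
  \<open>2 * len\<close> for noticing it.\<close>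

lemma greedy_forward_prob:
  assumes T: "card T \<le> card V" and large: "(4 * CARD('f) + 53) * card V \<le> len"
    and start: "iteration_start R s"
    and j: "iteration_potential (real (b\<^sup>2 div d)) (real group_size) (real (card (T - R))) \<le> real j"
    and t: "if card (T - R) = 0 then 2 * len \<le> t else 3 * len * (j + 1) + 2 * len \<le> t"
  shows "measure_pmf.prob (kernel_power greedy_round t s) (- {y. finished y})
    \<le> real (card (T - R)) * (card V * exp (- 24 * sqrt (card V)) + exp (- 12 * real (card V)))"
  using start j t
proof (induction "card (T - R)" arbitrary: R s j t rule: less_induct)
  case less
  let ?e = "card V * exp (- 24 * sqrt (card V)) + exp (- 12 * real (card V))"
  let ?\<phi> = "iteration_potential (real (b\<^sup>2 div d)) (real group_size)"
  have e0: "0 \<le> ?e" by simp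
  define k where "k = card (T - R)"
  show ?case
  proof (cases "k = 0")
    case True
    then have "T \<subseteq> R" using finite_T by (simp add: k_def)
    then have "iteration_start T s" using iteration_start_subset[OF less.prems(1)] less.prems(1) by simp
    moreover have "2 * len \<le> t" using less.prems(3) True by (simp add: k_def)
    ultimately have "measure_pmf.prob (kernel_power greedy_round t s) (- {y. finished y}) = 0"
      by (intro prob_eq_0I) (use no_tokens_left_finishes in blast)
    then show ?thesis by simp
  next
    case False
    then have t: "3 * len * (j + 1) + 2 * len \<le> t" using less.prems(3) by (simp add: k_def)
    have kpos: "0 < real k" using False by simp
    have g: "0 < real group_size" using group_size_pos by simp
    have "d \<le> b\<^sup>2" using d_le b_pos by (metis le_trans self_le_power zero_less_numeral)
    then have x: "0 < real (b\<^sup>2 div d)" using d_pos by (simp add: div_greater_zero_iff)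
    define r where "r = min (real (b\<^sup>2 div d)) (min (real k) (sqrt (real group_size * real k)))"
    have r: "0 < r" using kpos g x by (simp add: r_def)
    define G where "G = {y. \<exists>R'. iteration_start R' y \<and> real (card (T - R')) + r \<le> real k}"
    have e1: "measure_pmf.prob (kernel_power greedy_round (len + (len + len)) s) (- G) \<le> ?e"
      unfolding G_def r_def using iteration_prob[OF less.prems(1) k_def _ T large] False by simp
    have "measure_pmf.prob (kernel_power greedy_round (len + (len + len)) s \<bind>
        kernel_power greedy_round (t - (len + (len + len)))) (- {y. finished y}) \<le> ?e + (real k - 1) * ?e"
    proof (rule prob_bind_le[OF e1])
      show "0 \<le> (real k - 1) * ?e" using False e0 by (intro mult_nonneg_nonneg) (auto simp: Suc_leI)
      fix y assume "y \<in> G"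
      then obtain R' where R': "iteration_start R' y" "real (card (T - R')) + r \<le> real k"
        by (auto simp: G_def)
      have lt: "card (T - R') < k" using R' r by linarith
      have "measure_pmf.prob (kernel_power greedy_round (t - (len + (len + len))) y) (- {y. finished y})
          \<le> real (card (T - R')) * ?e"
      proof (cases "card (T - R') = 0")
        case True
        \<comment> \<open>With no tokens left the time bound is independent of \<open>j\<close>; the
          rounded potential at zero serves as witness.\<close>
        have "2 * len \<le> t - (len + (len + len))" using t by simp
        then show ?thesis
          using less.hyps[of R' y "nat \<lceil>?\<phi> 0\<rceil>"] lt True R'(1) by (simp add: k_def real_nat_ceiling_ge)
      next
        case nz: False
        have "?\<phi> (real (card (T - R'))) \<le> ?\<phi> (real k) - 1"
          using iteration_potential_decreases[OF x g kpos _ R'(2)[unfolded r_def]] nz by simp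
        then have \<phi>: "?\<phi> (real (card (T - R'))) \<le> real j - 1" using less.prems(2) by (simp add: k_def)
        \<comment> \<open>Nonnegativity shows that the budget \<open>j\<close> is not yet exhausted
          and can be lowered by one.\<close>
        moreover have "0 \<le> ?\<phi> (real (card (T - R')))" by (rule iteration_potential_nonneg[OF x g]) simp
        ultimately have "1 \<le> j" by linarith
        then obtain i where i: "j = Suc i" by (cases j) auto
        have "3 * len * (i + 1) + 2 * len \<le> t - (len + (len + len))" using t by (simp add: i algebra_simps)
        then show ?thesis
          using less.hyps[of R' y i] lt R'(1) \<phi> nz by (simp add: k_def i)
      qed
      also have "\<dots> \<le> (real k - 1) * ?e" using lt e0 by (intro mult_right_mono) linarith+
      finally show "measure_pmf.prob (kernel_power greedy_round (t - (len + (len + len))) y) (- {y. finished y})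
          \<le> (real k - 1) * ?e" .
    qed
    moreover have "len + (len + len) + (t - (len + (len + len))) = t" using t by simp
    ultimately have "measure_pmf.prob (kernel_power greedy_round t s) (- {y. finished y}) \<le> ?e + (real k - 1) * ?e"
      by (metis kernel_power_add)
    then show ?thesis by (simp add: k_def algebra_simps)
  qed
qed

section \<open>Message sizes\<close>

text \<open>Preserved by every possible round, also after failed decoding, so that the size bound is
  certain and not merely probable.\<close>

definition valid :: "(node \<Rightarrow> 'f local_state) \<Rightarrow> bool" where
  "valid \<sigma> \<longleftrightarrow> (\<exists>t. forwarding t \<sigma>) \<or> (\<exists>t. flooding t \<sigma>) \<or> (\<exists>xs t. coding xs t \<sigma>) \<or> halted \<sigma>"

lemma valid_step:
  assumes "valid \<sigma>" "possible_messages \<sigma> msg"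
  shows "valid (next_state h \<sigma> msg)"
proof -
  consider t where "forwarding t \<sigma>" | t where "flooding t \<sigma>" | xs t where "coding xs t \<sigma>" | "halted \<sigma>"
    using assms(1) by (auto simp: valid_def)
  then show ?thesis
  proof cases
    case (1 t)
    show ?thesis using forwarding_step(3,4)[OF 1 assms(2), of h] valid_def by metis
  next
    case (2 t)
    obtain c l where "best_candidate (candidates \<sigma>) = (c, l)" by force
    then show ?thesis using flooding_step(2-4)[OF 2 assms(2), where h = h] valid_def by metis
  next
    case (3 xs t)
    show ?thesis using coding_step(1,4)[OF 3 assms(2), of h] valid_def by metis
  next
    case 4
    show ?thesis using halted_step(1)[OF 4] unfolding valid_def by blast
  qed
qed

text \<open>Since \<open>b < 2 * (b div d) * d\<close>, a batch of at most
  \<open>b\<^sup>2 div d\<close> tokens makes at most \<open>2 * b\<close> blocks. This batch size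
  keeps the coefficient header within a constant factor of the payload.\<close>

lemma coded_dim_le:
  assumes "s \<le> b\<^sup>2 div d"
  shows "coded_dim b d s \<le> 3 * b"
proof -
  have g: "1 \<le> b div d" by (rule group_size_pos)
  have "b < (b div d + 1) * d" using dividend_less_div_times[of d b] d_pos by simp
  also have "\<dots> \<le> 2 * (b div d) * d" using g by (intro mult_right_mono) simp_all
  finally have "b * b \<le> b * (2 * (b div d) * d)" by (intro mult_left_mono) simp_all
  then have "b\<^sup>2 div d \<le> b * (2 * (b div d) * d) div d" unfolding power2_eq_square by (rule div_le_mono)
  also have "b * (2 * (b div d) * d) = 2 * b * (b div d) * d" by (simp only: ac_simps)
  also have "2 * b * (b div d) * d div d = 2 * b * (b div d)"
    by (rule nonzero_mult_div_cancel_right) (use d_pos in simp)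
  finally have "s \<le> 2 * b * (b div d)" using assms by simp
  then have "real s \<le> real (2 * b * (b div d))" by (rule of_nat_mono)
  then have "real s / real (b div d) \<le> real (2 * b)" using g by (simp add: pos_divide_le_eq)
  then have "num_blocks b d s \<le> 2 * b" unfolding num_blocks_def by (simp add: nat_le_iff ceiling_le_iff)
  moreover have "block_bits b d \<le> b" by (simp add: block_bits_def)
  ultimately show ?thesis by (simp add: coded_dim_def)
qed

lemma message_bits_le:
  fixes a :: nat
  assumes \<sigma>: "valid \<sigma>" and msg: "possible_messages \<sigma> msg" and v: "v \<in> V"
    and T: "card T \<le> card V" and ids: "\<forall>v\<in>V. floorlog 2 v \<le> a * floorlog 2 (card V)"
    and b: "log 2 (real (card V)) \<le> real b"
  shows "real (message_bits (msg v)) \<le> (6 + 2 * real a + 3 * real (nat \<lceil>log 2 (real CARD('f))\<rceil>)) * real b"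
proof -
  let ?Q = "nat \<lceil>log 2 (real CARD('f))\<rceil>"
  have n: "1 \<le> card V" using finite_V V_nonempty by (simp add: Suc_leI card_gt_0_iff)
  \<comment> \<open>\<open>floorlog\<close> may exceed the logarithm by one, which
    \<open>b \<ge> 1\<close> absorbs.\<close>
  have fl_n: "floorlog 2 (card V) \<le> 2 * b"
  proof -
    have "floorlog 2 (card V) = nat \<lfloor>log 2 (card V)\<rfloor> + 1" using n by (simp add: floorlog_def)
    moreover have "nat \<lfloor>log 2 (real (card V))\<rfloor> \<le> b"
      using b by (simp add: nat_le_iff floor_le_iff)
    ultimately show ?thesis using b_pos by simp
  qed
  consider t where "forwarding t \<sigma>" | t where "flooding t \<sigma>" | xs t where "coding xs t \<sigma>" | "halted \<sigma>"
    using \<sigma> by (auto simp: valid_def)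
  then have "message_bits (msg v) \<le> (6 + 2 * a + 3 * ?Q) * b"
  proof cases
    case (1 t)
    then obtain S where S: "msg v = Tokens S" "S \<subseteq> considered (\<sigma> v)" "card S \<le> group_size"
      using forwarding_message[OF _ msg v] by blast
    have "S \<subseteq> T" using S(2) considered_subset[of \<sigma> v] 1 v by (auto simp: forwarding_def)
    then have "(\<Sum>x\<in>S. length x) = card S * d" using length_T by (auto simp: subset_iff)
    also have "\<dots> \<le> b div d * d" using S(3) by (rule mult_right_mono) simp
    also have "\<dots> \<le> b" by simp
    finally have "message_bits (msg v) \<le> 3 * b" using S(1) b_pos by simp
    also have "\<dots> \<le> (6 + 2 * a + 3 * ?Q) * b" by (rule mult_right_mono) simp_all
    finally show ?thesis .
  next
    case (2 t)
    then obtain cand where cand: "stage (\<sigma> v) = Flooding t cand" "cand \<in> candidates \<sigma>"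
      using v unfolding flooding_def by metis
    then obtain u where u: "u \<in> V" "cand = (card (considered (\<sigma> u)), u)" by (auto simp: candidates_def)
    have "msg v = Candidate (fst cand) (snd cand)"
      using bspec[OF msg[unfolded possible_messages_def] v] cand by simp
    \<comment> \<open>The count is a number of tokens, so it takes no more bits than
      \<open>card V\<close>.\<close>
    moreover have "card (considered (\<sigma> u)) \<le> card V"
      using considered_subset[of \<sigma> u] 2 u T card_mono[OF finite_T, of "considered (\<sigma> u)"]
      by (simp add: flooding_def)
    then have "floorlog 2 (card (considered (\<sigma> u))) \<le> 2 * b" using floorlog_mono fl_n le_trans by blast
    moreover have "floorlog 2 u \<le> a * (2 * b)" using ids u(1) fl_n by (meson le_trans mult_le_mono2)
    ultimately have "message_bits (msg v) \<le> 2 * b + 2 * b + a * (2 * b)" using u(2) b_pos by simp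
    also have "\<dots> = (4 + 2 * a) * b" by (simp add: algebra_simps)
    also have "\<dots> \<le> (6 + 2 * a + 3 * ?Q) * b" by (rule mult_right_mono) simp_all
    finally show ?thesis .
  next
    case (3 xs t)
    obtain w where w: "msg v = Coded w" "consistent b d xs w" using coding_message[OF 3 msg v] by blast
    have "dim_vec w \<le> 3 * b" using w(2) coded_dim_le[of "length xs"] 3 by (simp add: consistent_def coding_def)
    then have "dim_vec w * ?Q \<le> 3 * b * ?Q" by (rule mult_right_mono) simp
    moreover have "message_bits (msg v) = 2 + dim_vec w * ?Q" using w(1) by simp
    ultimately have "message_bits (msg v) \<le> 2 * b + 3 * b * ?Q" using b_pos by linarith
    also have "\<dots> = (2 + 3 * ?Q) * b" by (simp add: algebra_simps)
    also have "\<dots> \<le> (6 + 2 * a + 3 * ?Q) * b" by (rule mult_right_mono) simp_all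
    finally show ?thesis .
  next
    case 4
    then have "msg v = Silent"
      using bspec[OF msg[unfolded possible_messages_def] v] v by (simp add: halted_def)
    then have "message_bits (msg v) \<le> 2 * b" using b_pos by simp
    also have "\<dots> \<le> (6 + 2 * a + 3 * ?Q) * b" by (rule mult_right_mono) simp_all
    finally show ?thesis .
  qed
  then have "real (message_bits (msg v)) \<le> real ((6 + 2 * a + 3 * ?Q) * b)" by (rule of_nat_mono)
  then show ?thesis by (simp only: of_nat_add of_nat_mult of_nat_numeral)
qed

lemma history_message_bits_le:
  fixes a :: nat
  assumes start: "valid \<sigma>0" and y: "(h, \<sigma>) \<in> set_pmf (kernel_power greedy_round t ([], \<sigma>0))"
    and "(msg, E) \<in> set h" "v \<in> V"
    and T: "card T \<le> card V" and ids: "\<forall>v\<in>V. floorlog 2 v \<le> a * floorlog 2 (card V)"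
    and b: "log 2 (real (card V)) \<le> real b"
  shows "real (message_bits (msg v)) \<le> (6 + 2 * real a + 3 * real (nat \<lceil>log 2 (real CARD('f))\<rceil>)) * real b"
proof -
  let ?B = "(6 + 2 * real a + 3 * real (nat \<lceil>log 2 (real CARD('f))\<rceil>)) * real b"
  define Inv where "Inv y \<longleftrightarrow> valid (snd y) \<and>
    (\<forall>(msg, E) \<in> set (fst y). \<forall>v\<in>V. real (message_bits (msg v)) \<le> ?B)"
    for y :: "'f message history \<times> (node \<Rightarrow> 'f local_state)"
  have "Inv (h, \<sigma>)"
  proof (rule kernel_power_invariant[where Inv = "\<lambda>_. Inv", OF _ _ y])
    show "Inv ([], \<sigma>0)" using start by (simp add: Inv_def)
    fix z w assume z: "Inv z" and w: "w \<in> set_pmf (greedy_round z)"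
    obtain h \<sigma> where z': "z = (h, \<sigma>)" by (cases z)
    obtain msg where msg: "possible_messages \<sigma> msg" "w = (h @ [(msg, adv h)], next_state h \<sigma> msg)"
      using w unfolding z' by (rule greedy_round_support)
    have \<sigma>: "valid \<sigma>" using z by (simp add: Inv_def z')
    show "Inv w"
      using z valid_step[OF \<sigma> msg(1), of h] message_bits_le[OF \<sigma> msg(1) _ T ids b]
      by (auto simp: Inv_def z' msg(2))
  qed
  then show ?thesis using assms(3,4) by (auto simp: Inv_def)
qed

end

section \<open>Numerical estimates and the choice of constants\<close>

lemma total_failure_le:
  fixes n k :: nat
  assumes n: "2 \<le> n" and k: "k \<le> n"
  shows "real k * (n * exp (- 24 * sqrt n) + exp (- 12 * real n)) \<le> 1 / n"
proof -
  define y where "y = sqrt (real n)"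
  have y: "1 \<le> y" "y\<^sup>2 = n" using n by (auto simp: y_def)
  have yn: "y \<le> n" using y mult_left_mono[of 1 y y] by (simp add: power2_eq_square)
  \<comment> \<open>Exponentials are traded for powers of \<open>y = sqrt n\<close>: the eighth
    yields \<open>1 / n^4\<close> and the sixth \<open>1 / n^3\<close>, so the total is
    \<open>2 / n^2\<close>, at most \<open>1 / n\<close> from \<open>n = 2\<close> on.\<close>
  have inv: "exp (- (real i * y)) \<le> 1 / y ^ i" for i
  proof -
    have "y \<le> exp y" using exp_ge_add_one_self[of y] by linarith
    then have "y ^ i \<le> exp y ^ i" using y by (intro power_mono) auto
    also have "\<dots> = exp (real i * y)" by (simp add: exp_of_nat_mult)
    finally show ?thesis using y by (simp add: exp_minus inverse_eq_divide frac_le)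
  qed
  have y8: "y ^ 8 = real n ^ 4" and y6: "y ^ 6 = real n ^ 3"
    using power_mult[of y 2 4] power_mult[of y 2 3] by (simp_all add: y)
  have "exp (- 24 * y) \<le> exp (- (real 8 * y))" using y by simp
  also have "\<dots> \<le> 1 / real n ^ 4" using inv[of 8] by (simp only: y8)
  finally have 1: "n * exp (- 24 * y) \<le> n * (1 / real n ^ 4)" by (rule mult_left_mono) simp
  have "exp (- 12 * real n) \<le> exp (- (real 6 * y))" using y yn by simp
  also have "\<dots> \<le> 1 / real n ^ 3" using inv[of 6] by (simp only: y6)
  finally have 2: "exp (- 12 * real n) \<le> 1 / real n ^ 3" .
  have "real k * (n * exp (- 24 * y) + exp (- 12 * real n)) \<le> n * (n * (1 / real n ^ 4) + 1 / real n ^ 3)"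
    by (rule mult_mono[OF _ add_mono[OF 1 2]]) (use k in auto)
  also have "\<dots> = 2 / (real n * real n)" using n by (simp add: field_simps power_numeral_reduce)
  also have "\<dots> \<le> 1 / n" using n by (simp add: field_simps)
  finally show ?thesis by (simp add: y_def)
qed

theorem theorem14:
  fixes a :: nat
  shows "\<exists>(\<alpha>::nat) (c::real) (B::real) (C::real). \<alpha> > 0 \<and> c > 0 \<and> B > 0 \<and> C > 0 \<and>
    (\<forall>(n::nat) (N::nat) (k::nat) (d::nat) (b::nat) (V::node set) (T::token set)
      (I::node \<Rightarrow> token set) (adv::'f::{field,finite} message adversary).
      n \<ge> 1 \<and> finite V \<and> card V = n \<and> (\<forall>v\<in>V. floorlog 2 v \<le> a * floorlog 2 n) \<and>
      n \<le> 2 * N \<and> N \<le> 2 * n \<and>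
      1 \<le> d \<and> d \<le> b \<and> log 2 (real n) \<le> real b \<and>
      finite T \<and> card T = k \<and> k \<le> n \<and> (\<forall>x\<in>T. length x = d) \<and> (\<Union>v\<in>V. I v) = T \<and>
      (\<forall>h. connected_graph V (adv h))
      \<longrightarrow>
      (let P = greedy_forward (\<alpha> * N) d b :: ('f local_state, 'f message) protocol;
           R = nat \<lfloor>C * (real n * real k * real d / real b ^ 2 + real n * real b)\<rfloor>
       in measure_pmf.prob (execution P V I adv R) {\<omega>. dissemination_done P V T \<omega>}
            \<ge> 1 - real n powr (- c) \<and>
          (\<forall>t. \<forall>(h, \<sigma>) \<in> set_pmf (execution P V I adv t). \<forall>(msg, E) \<in> set h. \<forall>v\<in>V.
             real (message_bits (msg v)) \<le> B * real b)))"
proof -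
  \<comment> \<open>Twice \<open>4 * CARD('f) + 53\<close>, because the estimate \<open>N\<close>
    may be as small as \<open>n / 2\<close>.\<close>
  define \<alpha> :: nat where "\<alpha> = 8 * CARD('f) + 106"
  define B where "B = 6 + 2 * real a + 3 * real (nat \<lceil>log 2 (real CARD('f))\<rceil>)"
  \<comment> \<open>A factor \<open>2 * \<alpha>\<close> from \<open>N \<le> 2 * n\<close> and a
    factor 20 from \<open>3 * (j + 1) + 2 \<le> 20 * (r + b)\<close>, where \<open>r\<close> is
    \<open>k * d / b\<^sup>2\<close>.\<close>
  define C where "C = 40 * real \<alpha>"
  have "1 - real n powr (- 1) \<le> measure_pmf.prob (execution P V I adv R) {\<omega>. dissemination_done P V T \<omega>} \<and>
      (\<forall>t. \<forall>(h, \<sigma>) \<in> set_pmf (execution P V I adv t). \<forall>(msg, E) \<in> set h. \<forall>v\<in>V.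
        real (message_bits (msg v)) \<le> B * real b)"
    if n: "n \<ge> 1" and V: "finite V" "card V = n" and ids: "\<forall>v\<in>V. floorlog 2 v \<le> a * floorlog 2 n"
      and N: "n \<le> 2 * N" "N \<le> 2 * n" and d: "1 \<le> d" "d \<le> b" and b: "log 2 (real n) \<le> real b"
      and T: "finite T" "card T = k" "k \<le> n" "\<forall>x\<in>T. length x = d" and I: "(\<Union>v\<in>V. I v) = T"
      and adv: "\<forall>h. connected_graph V (adv h)"
      and P: "P = greedy_forward (\<alpha> * N) d b"
      and R: "R = nat \<lfloor>C * (real n * real k * real d / real b ^ 2 + real n * real b)\<rfloor>"
    for n N k d b :: nat and V :: "node set" and T :: "token set" and I :: "node \<Rightarrow> token set"
      and adv :: "'f message adversary" and P :: "('f local_state, 'f message) protocol" and R :: nat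
  proof -
    let ?len = "\<alpha> * N"
    have large: "(4 * CARD('f) + 53) * card V \<le> ?len"
    proof -
      have "(4 * CARD('f) + 53) * n \<le> (4 * CARD('f) + 53) * (2 * N)" using N(1) by (rule mult_le_mono2)
      then show ?thesis by (simp add: V \<alpha>_def algebra_simps)
    qed
    have "card V \<le> (4 * CARD('f) + 53) * card V" by simp
    then have "card V \<le> ?len" using large by (rule le_trans)
    then interpret dissemination V T adv ?len d b
      using V n d T adv by unfold_locales auto
    define \<sigma>0 where "\<sigma>0 = (\<lambda>v. init_state P v (I v))"
    have init: "\<sigma>0 v = \<lparr>ident = v, known = I v, removed = {}, stage = Forwarding 0\<rparr>" for v
      by (simp add: \<sigma>0_def P greedy_forward_def)
    have fw: "forwarding 0 \<sigma>0" using I len_pos by (simp add: forwarding_def base_def init)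
    have start: "iteration_start {} ([], \<sigma>0)" using fw by (simp add: iteration_start_def init)
    have exec: "execution P V I adv t = kernel_power greedy_round t ([], \<sigma>0)" for t
      by (simp add: execution_eq_kernel_power \<sigma>0_def P)
    have "1 - real n powr (- 1) \<le> measure_pmf.prob (execution P V I adv R) {\<omega>. dissemination_done P V T \<omega>}"
    proof (cases "n = 1")
      \<comment> \<open>For a single node the claimed lower bound on the probability is
        zero.\<close>
      case True
      then show ?thesis by simp
    next
      case False
      let ?\<phi> = "iteration_potential (real (b\<^sup>2 div d)) (real group_size) (real k)"
      define r where "r = real k * real d / (real b)\<^sup>2"
      define j where "j = nat \<lceil>?\<phi>\<rceil>"
      have \<phi>j: "?\<phi> \<le> real j" by (simp add: j_def real_nat_ceiling_ge)
      have r0: "0 \<le> r" by (simp add: r_def)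
      have b1: "1 \<le> real b" using d by simp
      have "real j \<le> 2 * r + 4 * real b + 1"
      proof -
        have "?\<phi> \<le> 2 * r + 4 * real b" unfolding r_def by (rule iteration_potential_le[OF d])
        moreover have "real j \<le> max 0 (?\<phi> + 1)" unfolding j_def by linarith
        ultimately show ?thesis using r0 b1 by linarith
      qed
      moreover have "3 * (x + 1) + 2 \<le> 20 * (r + y)" if "x \<le> 2 * r + 4 * y + 1" "1 \<le> y" for x y :: real
        using that r0 unfolding distrib_left by linarith
      ultimately have "3 * (real j + 1) + 2 \<le> 20 * (r + real b)" using b1 by blast
      then have "real ?len * (3 * (real j + 1) + 2) \<le> real ?len * (20 * (r + real b))"
        by (rule mult_left_mono) simp
      also have "\<dots> \<le> (2 * real \<alpha> * real n) * (20 * (r + real b))"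
      proof (rule mult_right_mono)
        have "real (\<alpha> * N) \<le> real (\<alpha> * (2 * n))" using N(2) by (intro of_nat_mono mult_le_mono2)
        then show "real ?len \<le> 2 * real \<alpha> * real n" by (simp add: mult_ac)
        show "0 \<le> 20 * (r + real b)" using r0 by simp
      qed
      also have "\<dots> = C * (real n * real k * real d / real b ^ 2 + real n * real b)"
        by (simp add: C_def r_def algebra_simps)
      finally have "real (3 * ?len * (j + 1) + 2 * ?len) \<le> C * (real n * real k * real d / real b ^ 2 + real n * real b)"
        by (simp add: algebra_simps)
      then have t: "3 * ?len * (j + 1) + 2 * ?len \<le> R" unfolding R by (rule le_nat_floor)
      have t': "if k = 0 then 2 * ?len \<le> R else 3 * ?len * (j + 1) + 2 * ?len \<le> R"
        using t le_trans[OF le_add2 t] by (simp only: if_True if_False split: if_split) blast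
      have "measure_pmf.prob (kernel_power greedy_round R ([], \<sigma>0)) (- {y. finished y})
          \<le> real k * (n * exp (- 24 * sqrt n) + exp (- 12 * real n))"
        using greedy_forward_prob[OF _ large start, of j R] T(2,3) V(2) \<phi>j t' by simp
      also have "\<dots> \<le> 1 / n" using total_failure_le[of n k] False n T by simp
      also have "\<dots> = real n powr (- 1)" using n by (simp add: powr_minus divide_inverse)
      finally have fail: "measure_pmf.prob (kernel_power greedy_round R ([], \<sigma>0)) (- {y. finished y}) \<le> real n powr (- 1)" .
      have "1 - real n powr (- 1) \<le> measure_pmf.prob (kernel_power greedy_round R ([], \<sigma>0)) {y. finished y}"
        using fail measure_pmf.prob_compl[of "{y. finished y}" "kernel_power greedy_round R ([], \<sigma>0)"]
        by (simp add: Compl_eq_Diff_UNIV)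
      also have "\<dots> \<le> measure_pmf.prob (kernel_power greedy_round R ([], \<sigma>0)) {\<omega>. dissemination_done P V T \<omega>}"
        by (intro measure_pmf.finite_measure_mono)
          (auto simp: finished_def dissemination_done_def halted_def P greedy_forward_def)
      finally show ?thesis by (simp add: exec)
    qed
    moreover have "real (message_bits (msg v)) \<le> B * real b"
      if "(h, \<sigma>) \<in> set_pmf (execution P V I adv t)" "(msg, E) \<in> set h" "v \<in> V" for t h \<sigma> msg E v
      unfolding B_def using that fw ids b T V
      by (intro history_message_bits_le[of \<sigma>0 h \<sigma> t msg E v a]) (auto simp: exec valid_def)
    ultimately show ?thesis by blast
  qed
  note main = this
  show ?thesis
  proof (rule exI[of _ \<alpha>], rule exI[of _ 1], rule exI[of _ B], rule exI[of _ C], intro conjI allI impI, goal_cases)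
    case 1
    show ?case by (simp add: \<alpha>_def)
  next
    case 2
    show ?case by simp
  next
    case 3
    have "0 \<le> real (nat \<lceil>log 2 (real CARD('f))\<rceil>)" by (rule of_nat_0_le_iff)
    then show ?case unfolding B_def using of_nat_0_le_iff[of a] by linarith
  next
    case 4
    show ?case by (simp add: C_def \<alpha>_def)
  next
    case (5 n N k d b V T I adv)
    show ?case
      unfolding Let_def by (rule main[where n = n and N = N and k = k and d = d and b = b and T = T]) (use 5 in blast)+
  qed
qed

end
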